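(* Let $V$ be a vector space over $\Bbbk$ and let $W=\Bbbk\langle x,y\rangle\otimes V$. Let $\overline{T}(W)=\bigoplus_{n\ge1}W^{\otimes n}$ be the reduced tensor algebra, and let $h,\delta\colon\overline{T}(W)\to\overline{T}(W)$ be the linear maps $$h(g_1v_1\otimes\cdots\otimes g_nv_n)=\sum_{i=1}^ng_1v_1\otimes\cdots\otimes(xg_i)v_i\otimes\cdots\otimes g_nv_n,$$ $$\delta(g_1v_1\otimes\cdots\otimes g_nv_n)=(yg_1)v_1\otimes g_2v_2\otimes\cdots\otimes g_nv_n+\sum_{i=2}^ng_1v_1\otimes\cdots\otimes(xg_i)v_i\otimes\cdots\otimes g_nv_n,$$ for $g_i\in\Bbbk\langle x,y\rangle$, $v_i\in V$. Then $(\overline{T}(W),h,\delta)$ is a free object in the category $\mathbf{AsGDer}$: for any AsGDer triple $(B,h_B,\delta_B)$ and any linear map $\varphi\colon V\to B$, there exists a unique morphism $\overline{\varphi}\colon\overline{T}(W)\to B$ of AsGDer triples such that $\overline{\varphi}\circ i=\varphi$, where $i\colon V\to\overline{T}(W)$ is the linear map $i(v)=1\otimes v\in W\subset\overline{T}(W)$.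
   Context: $\Bbbk$ is a field of characteristic zero. $\Bbbk\langle x,y\rangle$ is the free unital associative algebra on two variables; $gv$ denotes $g\otimes v\in\Bbbk\langle x,y\rangle\otimes V$. The product on $\overline{T}(W)$ is concatenation. An AsGDer triple $(A,h,\delta)$ is a (non-unital, i.e. not necessarily unital) associative $\Bbbk$-algebra $A$ with a derivation $h$ and a linear map $\delta\colon A\to A$ satisfying $\delta(ab)=\delta(a)b+ah(b)$ for all $a,b\in A$. A morphism $(A,h_A,\delta_A)\to(B,h_B,\delta_B)$ is an associative algebra homomorphism $f\colon A\to B$ (no unit condition) with $h_B\circ f=f\circ h_A$ and $\delta_B\circ f=f\circ\delta_A$. $\mathbf{AsGDer}$ is the category of AsGDer triples. *)

theory Defs
  imports "HOL-Algebra.Module" "HOL-Algebra.QuotRing"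
begin

text \<open>
  Vector spaces over a field \<open>K\<close> are modules in the sense of \<^locale>\<open>module\<close>, and
  (not necessarily unital) algebras are such modules with a product. They share the record type
  of modules; its field \<open>one\<close> is meaningless unless stated otherwise, and so is \<open>mult\<close> for
  structures used only as vector spaces.
\<close>

definition char_zero :: "('k, 'm) ring_scheme \<Rightarrow> bool" where
  "char_zero K \<longleftrightarrow> (\<forall>n::nat. n > 0 \<longrightarrow> [n] \<cdot>\<^bsub>K\<^esub> \<one>\<^bsub>K\<^esub> \<noteq> \<zero>\<^bsub>K\<^esub>)"

definition linear_maps ::
  "('k, 'm) ring_scheme \<Rightarrow> ('k, 'a, 'n) module_scheme \<Rightarrow> ('k, 'b, 'p) module_scheme \<Rightarrow> ('a \<Rightarrow> 'b) set"
  where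
  "linear_maps K M N = {f \<in> carrier M \<rightarrow> carrier N.
     (\<forall>u\<in>carrier M. \<forall>v\<in>carrier M. f (u \<oplus>\<^bsub>M\<^esub> v) = f u \<oplus>\<^bsub>N\<^esub> f v) \<and>
     (\<forall>c\<in>carrier K. \<forall>u\<in>carrier M. f (c \<odot>\<^bsub>M\<^esub> u) = c \<odot>\<^bsub>N\<^esub> f u)}"

section \<open>AsGDer triples\<close>

text \<open>The library locale \<^locale>\<open>algebra\<close> is about commutative unital algebras.\<close>

locale nonunital_algebra = module K A
  for K :: "('k, 'm) ring_scheme" (structure) and A :: "('k, 'a, 'n) module_scheme" (structure) +
  assumes mult_closed:
      "\<lbrakk>a \<in> carrier A; b \<in> carrier A\<rbrakk> \<Longrightarrow> a \<otimes>\<^bsub>A\<^esub> b \<in> carrier A"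
    and mult_assoc:
      "\<lbrakk>a \<in> carrier A; b \<in> carrier A; c \<in> carrier A\<rbrakk> \<Longrightarrow>
        (a \<otimes>\<^bsub>A\<^esub> b) \<otimes>\<^bsub>A\<^esub> c = a \<otimes>\<^bsub>A\<^esub> (b \<otimes>\<^bsub>A\<^esub> c)"
    and mult_add_left:
      "\<lbrakk>a \<in> carrier A; b \<in> carrier A; c \<in> carrier A\<rbrakk> \<Longrightarrow>
        (a \<oplus>\<^bsub>A\<^esub> b) \<otimes>\<^bsub>A\<^esub> c = a \<otimes>\<^bsub>A\<^esub> c \<oplus>\<^bsub>A\<^esub> b \<otimes>\<^bsub>A\<^esub> c"
    and mult_add_right:
      "\<lbrakk>a \<in> carrier A; b \<in> carrier A; c \<in> carrier A\<rbrakk> \<Longrightarrow>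
        a \<otimes>\<^bsub>A\<^esub> (b \<oplus>\<^bsub>A\<^esub> c) = a \<otimes>\<^bsub>A\<^esub> b \<oplus>\<^bsub>A\<^esub> a \<otimes>\<^bsub>A\<^esub> c"
    and mult_smult_left:
      "\<lbrakk>r \<in> carrier K; a \<in> carrier A; b \<in> carrier A\<rbrakk> \<Longrightarrow>
        (r \<odot>\<^bsub>A\<^esub> a) \<otimes>\<^bsub>A\<^esub> b = r \<odot>\<^bsub>A\<^esub> (a \<otimes>\<^bsub>A\<^esub> b)"
    and mult_smult_right:
      "\<lbrakk>r \<in> carrier K; a \<in> carrier A; b \<in> carrier A\<rbrakk> \<Longrightarrow>
        a \<otimes>\<^bsub>A\<^esub> (r \<odot>\<^bsub>A\<^esub> b) = r \<odot>\<^bsub>A\<^esub> (a \<otimes>\<^bsub>A\<^esub> b)"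

locale asgder = nonunital_algebra K A
  for K :: "('k, 'm) ring_scheme" (structure) and A :: "('k, 'a, 'n) module_scheme" (structure)
    and h :: "'a \<Rightarrow> 'a" and \<delta> :: "'a \<Rightarrow> 'a" +
  assumes h_linear: "h \<in> linear_maps K A A"
    and h_derivation:
      "\<lbrakk>a \<in> carrier A; b \<in> carrier A\<rbrakk> \<Longrightarrow> h (a \<otimes>\<^bsub>A\<^esub> b) = h a \<otimes>\<^bsub>A\<^esub> b \<oplus>\<^bsub>A\<^esub> a \<otimes>\<^bsub>A\<^esub> h b"
    and \<delta>_linear: "\<delta> \<in> linear_maps K A A"
    and \<delta>_mult:
      "\<lbrakk>a \<in> carrier A; b \<in> carrier A\<rbrakk> \<Longrightarrow> \<delta> (a \<otimes>\<^bsub>A\<^esub> b) = \<delta> a \<otimes>\<^bsub>A\<^esub> b \<oplus>\<^bsub>A\<^esub> a \<otimes>\<^bsub>A\<^esub> h b"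

text \<open>Morphisms are extensional, so that two of them are equal iff they agree on the carrier.\<close>

definition asgder_morphisms ::
  "('k, 'm) ring_scheme
    \<Rightarrow> ('k, 'a, 'n) module_scheme \<Rightarrow> ('a \<Rightarrow> 'a) \<Rightarrow> ('a \<Rightarrow> 'a)
    \<Rightarrow> ('k, 'b, 'p) module_scheme \<Rightarrow> ('b \<Rightarrow> 'b) \<Rightarrow> ('b \<Rightarrow> 'b) \<Rightarrow> ('a \<Rightarrow> 'b) set" where
  "asgder_morphisms K A h\<^sub>A \<delta>\<^sub>A B h\<^sub>B \<delta>\<^sub>B = {f \<in> linear_maps K A B \<inter> extensional (carrier A).
     (\<forall>a\<in>carrier A. \<forall>b\<in>carrier A. f (a \<otimes>\<^bsub>A\<^esub> b) = f a \<otimes>\<^bsub>B\<^esub> f b) \<and>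
     (\<forall>a\<in>carrier A. h\<^sub>B (f a) = f (h\<^sub>A a)) \<and>
     (\<forall>a\<in>carrier A. \<delta>\<^sub>B (f a) = f (\<delta>\<^sub>A a))}"

section \<open>Free vector spaces, monoid algebras of words, quotients\<close>

definition delta_fun :: "('k, 'm) ring_scheme \<Rightarrow> 'x \<Rightarrow> 'x \<Rightarrow> 'k" where
  "delta_fun K b = (\<lambda>x. if x = b then \<one>\<^bsub>K\<^esub> else \<zero>\<^bsub>K\<^esub>)"

definition free_module :: "('k, 'm) ring_scheme \<Rightarrow> 'x set \<Rightarrow> ('k, 'x \<Rightarrow> 'k) module" where
  "free_module K S =
     \<lparr>carrier = {f. (\<forall>x\<in>S. f x \<in> carrier K) \<and> (\<forall>x. x \<notin> S \<longrightarrow> f x = \<zero>\<^bsub>K\<^esub>) \<and>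
        finite {x. f x \<noteq> \<zero>\<^bsub>K\<^esub>}},
      mult = undefined, one = undefined,
      zero = (\<lambda>_. \<zero>\<^bsub>K\<^esub>),
      add = (\<lambda>f g x. f x \<oplus>\<^bsub>K\<^esub> g x),
      smult = (\<lambda>c f x. c \<otimes>\<^bsub>K\<^esub> f x)\<rparr>"

text \<open>
  The free vector space on a set \<open>L\<close> of words closed under concatenation, with the product
  extending concatenation. Its \<open>one\<close> is a unit if \<open>L\<close> contains the empty word, and is
  meaningless otherwise.
\<close>

definition word_algebra ::
  "('k, 'm) ring_scheme \<Rightarrow> 'x list set \<Rightarrow> ('k, 'x list \<Rightarrow> 'k) module" where
  "word_algebra K L = (free_module K L)
     \<lparr>mult := (\<lambda>f g w. \<Oplus>\<^bsub>K\<^esub>i\<in>{..length w}. f (take i w) \<otimes>\<^bsub>K\<^esub> g (drop i w)),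
      one := delta_fun K []\<rparr>"

definition submodule_span ::
  "('k, 'm) ring_scheme \<Rightarrow> ('k, 'a, 'n) module_scheme \<Rightarrow> 'a set \<Rightarrow> 'a set" where
  "submodule_span K M R = \<Inter>{H. submodule H K M \<and> R \<subseteq> H}"

definition quot_module ::
  "('k, 'a, 'n) module_scheme \<Rightarrow> 'a set \<Rightarrow> ('k, 'a set) module" where
  "quot_module M N =
     \<lparr>carrier = a_rcosets\<^bsub>M\<^esub> N, mult = rcoset_mult M N, one = N +>\<^bsub>M\<^esub> \<one>\<^bsub>M\<^esub>,
      zero = N, add = set_add M,
      smult = (\<lambda>c C. \<Union>a\<in>C. N +>\<^bsub>M\<^esub> (c \<odot>\<^bsub>M\<^esub> a))\<rparr>"

section \<open>Tensor products and the reduced tensor algebra\<close>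

definition tensor_rels ::
  "('k, 'm) ring_scheme \<Rightarrow> ('k, 'a, 'n) module_scheme \<Rightarrow> ('k, 'b, 'p) module_scheme
    \<Rightarrow> ('a \<times> 'b \<Rightarrow> 'k) set" where
  "tensor_rels K U V = (let F = free_module K (carrier U \<times> carrier V); e = delta_fun K in
     {e (u \<oplus>\<^bsub>U\<^esub> u', v) \<ominus>\<^bsub>F\<^esub> (e (u, v) \<oplus>\<^bsub>F\<^esub> e (u', v)) |
        u u' v. u \<in> carrier U \<and> u' \<in> carrier U \<and> v \<in> carrier V} \<union>
     {e (u, v \<oplus>\<^bsub>V\<^esub> v') \<ominus>\<^bsub>F\<^esub> (e (u, v) \<oplus>\<^bsub>F\<^esub> e (u, v')) |
        u v v'. u \<in> carrier U \<and> v \<in> carrier V \<and> v' \<in> carrier V} \<union>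
     {e (c \<odot>\<^bsub>U\<^esub> u, v) \<ominus>\<^bsub>F\<^esub> c \<odot>\<^bsub>F\<^esub> e (u, v) |
        c u v. c \<in> carrier K \<and> u \<in> carrier U \<and> v \<in> carrier V} \<union>
     {e (u, c \<odot>\<^bsub>V\<^esub> v) \<ominus>\<^bsub>F\<^esub> c \<odot>\<^bsub>F\<^esub> e (u, v) |
        c u v. c \<in> carrier K \<and> u \<in> carrier U \<and> v \<in> carrier V})"

definition tensor_null ::
  "('k, 'm) ring_scheme \<Rightarrow> ('k, 'a, 'n) module_scheme \<Rightarrow> ('k, 'b, 'p) module_scheme
    \<Rightarrow> ('a \<times> 'b \<Rightarrow> 'k) set" where
  "tensor_null K U V =
     submodule_span K (free_module K (carrier U \<times> carrier V)) (tensor_rels K U V)"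

definition tensor_product ::
  "('k, 'm) ring_scheme \<Rightarrow> ('k, 'a, 'n) module_scheme \<Rightarrow> ('k, 'b, 'p) module_scheme
    \<Rightarrow> ('k, ('a \<times> 'b \<Rightarrow> 'k) set) module" where
  "tensor_product K U V =
     quot_module (free_module K (carrier U \<times> carrier V)) (tensor_null K U V)"

definition pure_tensor ::
  "('k, 'm) ring_scheme \<Rightarrow> ('k, 'a, 'n) module_scheme \<Rightarrow> ('k, 'b, 'p) module_scheme
    \<Rightarrow> 'a \<Rightarrow> 'b \<Rightarrow> ('a \<times> 'b \<Rightarrow> 'k) set" where
  "pure_tensor K U V u v =
     tensor_null K U V +>\<^bsub>free_module K (carrier U \<times> carrier V)\<^esub> delta_fun K (u, v)"

text \<open>
  \<open>W\<^sup>\<otimes>\<^sup>n\<close> is the free vector space on the words of length \<open>n\<close> over \<open>W\<close> modulo multilinearity in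
  each position. These relations are homogeneous in \<open>n\<close>, so the direct sum over \<open>n \<ge> 1\<close> is the
  free vector space on all nonempty words modulo all of them. As they are stable under
  concatenation with words on both sides, the product of words descends to the quotient.
\<close>

abbreviation nonempty_words :: "'x set \<Rightarrow> 'x list set" where
  "nonempty_words S \<equiv> lists S - {[]}"

definition multilinear_rels ::
  "('k, 'm) ring_scheme \<Rightarrow> ('k, 'w, 'n) module_scheme \<Rightarrow> ('w list \<Rightarrow> 'k) set" where
  "multilinear_rels K W =
    (let F = word_algebra K (nonempty_words (carrier W)); e = delta_fun K in
     {e (p @ [w \<oplus>\<^bsub>W\<^esub> w'] @ q) \<ominus>\<^bsub>F\<^esub> (e (p @ [w] @ q) \<oplus>\<^bsub>F\<^esub> e (p @ [w'] @ q)) |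
        p q w w'. p \<in> lists (carrier W) \<and> q \<in> lists (carrier W) \<and>
          w \<in> carrier W \<and> w' \<in> carrier W} \<union>
     {e (p @ [c \<odot>\<^bsub>W\<^esub> w] @ q) \<ominus>\<^bsub>F\<^esub> c \<odot>\<^bsub>F\<^esub> e (p @ [w] @ q) |
        p q c w. p \<in> lists (carrier W) \<and> q \<in> lists (carrier W) \<and>
          c \<in> carrier K \<and> w \<in> carrier W})"

definition multilinear_null ::
  "('k, 'm) ring_scheme \<Rightarrow> ('k, 'w, 'n) module_scheme \<Rightarrow> ('w list \<Rightarrow> 'k) set" where
  "multilinear_null K W =
     submodule_span K (word_algebra K (nonempty_words (carrier W))) (multilinear_rels K W)"

definition red_tensor_algebra ::
  "('k, 'm) ring_scheme \<Rightarrow> ('k, 'w, 'n) module_scheme \<Rightarrow> ('k, ('w list \<Rightarrow> 'k) set) module" where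
  "red_tensor_algebra K W =
     quot_module (word_algebra K (nonempty_words (carrier W))) (multilinear_null K W)"

definition tensor_word ::
  "('k, 'm) ring_scheme \<Rightarrow> ('k, 'w, 'n) module_scheme \<Rightarrow> 'w list \<Rightarrow> ('w list \<Rightarrow> 'k) set" where
  "tensor_word K W ws =
     multilinear_null K W +>\<^bsub>word_algebra K (nonempty_words (carrier W))\<^esub> delta_fun K ws"

section \<open>The triple on the reduced tensor algebra\<close>

datatype letter = LX | LY

definition free_algebra_xy :: "('k, 'm) ring_scheme \<Rightarrow> ('k, letter list \<Rightarrow> 'k) module" where
  "free_algebra_xy K = word_algebra K UNIV"

abbreviation var_xy :: "('k, 'm) ring_scheme \<Rightarrow> letter \<Rightarrow> letter list \<Rightarrow> 'k" where
  "var_xy K a \<equiv> delta_fun K [a]"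

type_synonym ('k, 'v) wspace = "((letter list \<Rightarrow> 'k) \<times> 'v \<Rightarrow> 'k) set"
type_synonym ('k, 'v) tspace = "(('k, 'v) wspace list \<Rightarrow> 'k) set"

definition W_space ::
  "('k, 'm) ring_scheme \<Rightarrow> ('k, 'v, 'n) module_scheme \<Rightarrow> ('k, ('k, 'v) wspace) module" where
  "W_space K V = tensor_product K (free_algebra_xy K) V"

definition TW ::
  "('k, 'm) ring_scheme \<Rightarrow> ('k, 'v, 'n) module_scheme \<Rightarrow> ('k, ('k, 'v) tspace) module" where
  "TW K V = red_tensor_algebra K (W_space K V)"

text \<open>The element \<open>g\<^sub>1v\<^sub>1 \<otimes> \<dots> \<otimes> g\<^sub>nv\<^sub>n\<close>, for the list of the pairs \<open>(g\<^sub>i, v\<^sub>i)\<close>.\<close>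

definition gv_tensor ::
  "('k, 'm) ring_scheme \<Rightarrow> ('k, 'v, 'n) module_scheme \<Rightarrow> ((letter list \<Rightarrow> 'k) \<times> 'v) list
    \<Rightarrow> ('k, 'v) tspace" where
  "gv_tensor K V gvs =
     tensor_word K (W_space K V) (map (\<lambda>(g, v). pure_tensor K (free_algebra_xy K) V g v) gvs)"

text \<open>The same element with \<open>g\<^sub>i\<close> multiplied on the left by a variable; here positions start at 0.\<close>

definition gv_tensor_mult_at ::
  "('k, 'm) ring_scheme \<Rightarrow> ('k, 'v, 'n) module_scheme \<Rightarrow> letter \<Rightarrow> nat
    \<Rightarrow> ((letter list \<Rightarrow> 'k) \<times> 'v) list \<Rightarrow> ('k, 'v) tspace" where
  "gv_tensor_mult_at K V a i gvs =
     gv_tensor K V (gvs[i := (var_xy K a \<otimes>\<^bsub>free_algebra_xy K\<^esub> fst (gvs ! i), snd (gvs ! i))])"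

text \<open>
  The defining formulas of \<open>h\<close> and \<open>\<delta>\<close>. The elements \<open>g\<^sub>1v\<^sub>1 \<otimes> \<dots> \<otimes> g\<^sub>nv\<^sub>n\<close> span, so each of
  these predicates determines the map on the carrier of the algebra.
\<close>

definition is_h ::
  "('k, 'm) ring_scheme \<Rightarrow> ('k, 'v, 'n) module_scheme
    \<Rightarrow> (('k, 'v) tspace \<Rightarrow> ('k, 'v) tspace) \<Rightarrow> bool" where
  "is_h K V h \<longleftrightarrow> h \<in> linear_maps K (TW K V) (TW K V) \<and>
     (\<forall>gvs \<in> nonempty_words (carrier (free_algebra_xy K) \<times> carrier V).
        h (gv_tensor K V gvs) =
          (\<Oplus>\<^bsub>TW K V\<^esub>i\<in>{..<length gvs}. gv_tensor_mult_at K V LX i gvs))"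

definition is_\<delta> ::
  "('k, 'm) ring_scheme \<Rightarrow> ('k, 'v, 'n) module_scheme
    \<Rightarrow> (('k, 'v) tspace \<Rightarrow> ('k, 'v) tspace) \<Rightarrow> bool" where
  "is_\<delta> K V \<delta> \<longleftrightarrow> \<delta> \<in> linear_maps K (TW K V) (TW K V) \<and>
     (\<forall>gvs \<in> nonempty_words (carrier (free_algebra_xy K) \<times> carrier V).
        \<delta> (gv_tensor K V gvs) = gv_tensor_mult_at K V LY 0 gvs \<oplus>\<^bsub>TW K V\<^esub>
          (\<Oplus>\<^bsub>TW K V\<^esub>i\<in>{1..<length gvs}. gv_tensor_mult_at K V LX i gvs))"

definition incl_V ::
  "('k, 'm) ring_scheme \<Rightarrow> ('k, 'v, 'n) module_scheme \<Rightarrow> 'v \<Rightarrow> ('k, 'v) tspace" where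
  "incl_V K V v = gv_tensor K V [(\<one>\<^bsub>free_algebra_xy K\<^esub>, v)]"

end

theory Submission
  imports Defs
begin

text \<open>
  \<open>W\<close> is spanned by the elements \<open>wv\<close> with \<open>w\<close> a word in \<open>x\<close>, \<open>y\<close>. A morphism sends
  \<open>h(wv) = (xw)v\<close> to \<open>h\<^sub>B\<close> of the image of \<open>wv\<close> and \<open>\<delta>(wv) = (yw)v\<close> to \<open>\<delta>\<^sub>B\<close> of it, so the image of
  \<open>wv\<close> must be \<open>w(h\<^sub>B, \<delta>\<^sub>B)(\<phi>(v))\<close>; since \<open>W\<close> generates the tensor algebra, this gives uniqueness.
  Conversely, this formula is linear in \<open>v\<close>, so it defines a linear map on \<open>W\<close>, which extends to an
  algebra homomorphism. The elements on which it commutes with \<open>h\<close> form a subalgebra by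
  the Leibniz rule, and so do those on which it commutes with \<open>\<delta>\<close>, because the rule for \<open>\<delta>\<close>
  involves only \<open>\<delta>\<close> and \<open>h\<close>. Both contain the generators \<open>wv\<close>.
\<close>

section \<open>Linear maps and spans\<close>

text \<open>All spaces are quotients of spaces of finitely supported functions, and no basis of
  \<open>V\<close> is chosen. Maps out of them therefore come from universal properties, by checking
  that a prescription on generators kills the relations, and identities are checked on spanning
  sets, one argument at a time. The predicates \<open>is_h\<close> and \<open>is_\<delta>\<close>
  prescribe values on tensors that satisfy many linear relations, so it has to be proved that such
  maps exist at all. Both come from one construction: for linear maps \<open>D i\<close> of
  \<open>W\<close>, the sum over the positions \<open>i\<close> of the tensors with letter
  \<open>i\<close> sent through \<open>D i\<close> is multilinear. With \<open>X a\<close> for left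
  multiplication by the variable \<open>a\<close> on the first factor of \<open>W\<close>, the
  choice \<open>D i = X LX\<close> gives \<open>h\<close>, and changing \<open>D 0\<close> to
  \<open>X LY\<close> gives \<open>\<delta>\<close>. This also explains the asymmetric rule for
  \<open>\<delta>\<close>: in a product of two tensors, position 0 always belongs to the first
  factor, so on the second factor \<open>\<delta>\<close> acts just as \<open>h\<close>
  does.\<close>

lemma linear_mapsI:
  assumes "\<And>u. u \<in> carrier M \<Longrightarrow> f u \<in> carrier N"
    and "\<And>u v. u \<in> carrier M \<Longrightarrow> v \<in> carrier M \<Longrightarrow> f (u \<oplus>\<^bsub>M\<^esub> v) = f u \<oplus>\<^bsub>N\<^esub> f v"
    and "\<And>c u. c \<in> carrier K \<Longrightarrow> u \<in> carrier M \<Longrightarrow> f (c \<odot>\<^bsub>M\<^esub> u) = c \<odot>\<^bsub>N\<^esub> f u"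
  shows "f \<in> linear_maps K M N"
  using assms by (auto simp: linear_maps_def)

lemma linear_maps_closed: "f \<in> linear_maps K M N \<Longrightarrow> u \<in> carrier M \<Longrightarrow> f u \<in> carrier N"
  by (auto simp: linear_maps_def)

lemma linear_maps_add:
  "f \<in> linear_maps K M N \<Longrightarrow> u \<in> carrier M \<Longrightarrow> v \<in> carrier M \<Longrightarrow> f (u \<oplus>\<^bsub>M\<^esub> v) = f u \<oplus>\<^bsub>N\<^esub> f v"
  by (auto simp: linear_maps_def)

lemma linear_maps_smult:
  "f \<in> linear_maps K M N \<Longrightarrow> c \<in> carrier K \<Longrightarrow> u \<in> carrier M \<Longrightarrow> f (c \<odot>\<^bsub>M\<^esub> u) = c \<odot>\<^bsub>N\<^esub> f u"
  by (auto simp: linear_maps_def)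

lemma linear_maps_cong:
  assumes "module K M" "f \<in> linear_maps K M N" "\<And>x. x \<in> carrier M \<Longrightarrow> f x = g x"
  shows "g \<in> linear_maps K M N"
proof -
  interpret M: module K M by fact
  show ?thesis
    using assms(2,3) by (auto simp: linear_maps_def Pi_def)
qed

lemma linear_maps_ident: "(\<lambda>x. x) \<in> linear_maps K M M"
  by (auto simp: linear_maps_def)

lemma linear_maps_compose:
  "f \<in> linear_maps K M N \<Longrightarrow> g \<in> linear_maps K N P \<Longrightarrow> (\<lambda>x. g (f x)) \<in> linear_maps K M P"
  by (auto simp: linear_maps_def Pi_def)

lemma linear_maps_zero:
  assumes "module K M" "module K N" "f \<in> linear_maps K M N"
  shows "f \<zero>\<^bsub>M\<^esub> = \<zero>\<^bsub>N\<^esub>"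
proof -
  interpret M: module K M by fact
  interpret N: module K N by fact
  have "f \<zero>\<^bsub>M\<^esub> = f (\<zero>\<^bsub>K\<^esub> \<odot>\<^bsub>M\<^esub> \<zero>\<^bsub>M\<^esub>)" by simp
  also have "\<dots> = \<zero>\<^bsub>N\<^esub>"
    using linear_maps_closed[OF assms(3)] by (simp add: linear_maps_smult[OF assms(3)] del: M.smult_l_null M.smult_r_null)
  finally show ?thesis .
qed

lemma linear_maps_minus:
  assumes "module K M" "module K N" "f \<in> linear_maps K M N" "u \<in> carrier M" "v \<in> carrier M"
  shows "f (u \<ominus>\<^bsub>M\<^esub> v) = f u \<ominus>\<^bsub>N\<^esub> f v"
proof -
  interpret M: module K M by fact
  interpret N: module K N by fact
  note f = linear_maps_closed[OF assms(3)] linear_maps_add[OF assms(3)]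
  have "f (u \<ominus>\<^bsub>M\<^esub> v) \<oplus>\<^bsub>N\<^esub> f v = f u"
    using assms(4,5) f(2)[of "u \<ominus>\<^bsub>M\<^esub> v" v, symmetric]
    by (simp add: a_minus_def M.M.a_assoc M.M.l_neg)
  moreover have "f (u \<ominus>\<^bsub>M\<^esub> v) = (f (u \<ominus>\<^bsub>M\<^esub> v) \<oplus>\<^bsub>N\<^esub> f v) \<ominus>\<^bsub>N\<^esub> f v"
    using assms(4,5) f(1) by (simp add: a_minus_def N.M.a_assoc N.M.r_neg)
  ultimately show ?thesis by simp
qed

lemma linear_maps_minus_eq_zero:
  assumes "module K M" "module K N" "f \<in> linear_maps K M N" "u \<in> carrier M" "v \<in> carrier M" "f u = f v"
  shows "f (u \<ominus>\<^bsub>M\<^esub> v) = \<zero>\<^bsub>N\<^esub>"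
proof -
  interpret N: module K N by fact
  have "f (u \<ominus>\<^bsub>M\<^esub> v) = f v \<ominus>\<^bsub>N\<^esub> f v" using assms(6) linear_maps_minus[OF assms(1-5)] by simp
  then show ?thesis
    using linear_maps_closed[OF assms(3,5)] by (simp add: a_minus_def N.M.r_neg)
qed

lemma linear_maps_plus:
  assumes "module K N" "f \<in> linear_maps K M N" "g \<in> linear_maps K M N"
  shows "(\<lambda>x. f x \<oplus>\<^bsub>N\<^esub> g x) \<in> linear_maps K M N"
proof -
  interpret N: module K N by fact
  note fg = linear_maps_closed[OF assms(2)] linear_maps_closed[OF assms(3)]
  show ?thesis
    using fg by (intro linear_mapsI)
      (auto simp: linear_maps_add[OF assms(2)] linear_maps_add[OF assms(3)]
        linear_maps_smult[OF assms(2)] linear_maps_smult[OF assms(3)]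
        N.smult_r_distr N.M.a_ac)
qed

lemma (in nonunital_algebra) mult_linear:
  assumes "a \<in> carrier A"
  shows "(\<lambda>x. x \<otimes>\<^bsub>A\<^esub> a) \<in> linear_maps K A A" "(\<lambda>x. a \<otimes>\<^bsub>A\<^esub> x) \<in> linear_maps K A A"
  using assms by (auto intro!: linear_mapsI
      simp: mult_closed mult_add_left mult_add_right mult_smult_left mult_smult_right)

lemma linear_maps_finsum:
  assumes "module K M" "module K N" "f \<in> linear_maps K M N" "finite I" "\<And>i. i \<in> I \<Longrightarrow> x i \<in> carrier M"
  shows "f (\<Oplus>\<^bsub>M\<^esub>i\<in>I. x i) = (\<Oplus>\<^bsub>N\<^esub>i\<in>I. f (x i))"
proof -
  interpret M: module K M by fact
  interpret N: module K N by fact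
  show ?thesis
    using assms(4,5)
  proof (induction I rule: finite_induct)
    case empty
    then show ?case by (simp add: linear_maps_zero[OF assms(1-3)])
  next
    case (insert i I)
    then show ?case
      by (subst M.M.finsum_insert N.M.finsum_insert; auto simp: Pi_def linear_maps_closed[OF assms(3)] linear_maps_add[OF assms(3)])+
  qed
qed

lemma linear_maps_finsum_fun:
  assumes "module K M" "module K N" "finite I" "\<And>i. i \<in> I \<Longrightarrow> f i \<in> linear_maps K M N"
  shows "(\<lambda>x. \<Oplus>\<^bsub>N\<^esub>i\<in>I. f i x) \<in> linear_maps K M N"
proof -
  interpret N: module K N by fact
  show ?thesis
    using assms(3,4)
  proof (induction I rule: finite_induct)
    case empty
    then show ?case by (intro linear_mapsI) auto
  next
    case (insert i I)
    have "(\<lambda>x. f i x \<oplus>\<^bsub>N\<^esub> (\<Oplus>\<^bsub>N\<^esub>i\<in>I. f i x)) \<in> linear_maps K M N"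
      using insert by (intro linear_maps_plus assms(2)) auto
    moreover have "f i x \<oplus>\<^bsub>N\<^esub> (\<Oplus>\<^bsub>N\<^esub>i\<in>I. f i x) = (\<Oplus>\<^bsub>N\<^esub>i\<in>insert i I. f i x)" if "x \<in> carrier M" for x
      using insert.hyps linear_maps_closed[OF insert.prems that]
      by (subst N.M.finsum_insert) auto
    ultimately show ?case by (rule linear_maps_cong[OF assms(1)])
  qed
qed

text \<open>Closure under negation follows from scaling by -1.\<close>

lemma submoduleI':
  assumes "module K M" "H \<subseteq> carrier M" "\<zero>\<^bsub>M\<^esub> \<in> H"
    and "\<And>a b. a \<in> H \<Longrightarrow> b \<in> H \<Longrightarrow> a \<oplus>\<^bsub>M\<^esub> b \<in> H"
    and "\<And>c a. c \<in> carrier K \<Longrightarrow> a \<in> H \<Longrightarrow> c \<odot>\<^bsub>M\<^esub> a \<in> H"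
  shows "submodule H K M"
proof -
  interpret M: module K M by fact
  have "\<ominus>\<^bsub>M\<^esub> a \<in> H" if "a \<in> H" for a
    using assms(5)[of "\<ominus>\<^bsub>K\<^esub> \<one>\<^bsub>K\<^esub>" a] that assms(2) by (auto simp: M.smult_l_minus)
  then show ?thesis
    using assms by (intro M.submoduleI) auto
qed

lemma submoduleD:
  assumes "module K M" "submodule H K M"
  shows "H \<subseteq> carrier M" "\<zero>\<^bsub>M\<^esub> \<in> H"
    "\<And>a b. a \<in> H \<Longrightarrow> b \<in> H \<Longrightarrow> a \<oplus>\<^bsub>M\<^esub> b \<in> H"
    "\<And>a b. a \<in> H \<Longrightarrow> b \<in> H \<Longrightarrow> a \<ominus>\<^bsub>M\<^esub> b \<in> H"
    "\<And>c a. c \<in> carrier K \<Longrightarrow> a \<in> H \<Longrightarrow> c \<odot>\<^bsub>M\<^esub> a \<in> H"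
proof -
  interpret M: module K M by fact
  show "\<zero>\<^bsub>M\<^esub> \<in> H"
    using subgroup.one_closed[OF submodule.axioms(1)[OF assms(2)]] by simp
qed (use module.submoduleE[OF assms] in \<open>auto simp: a_minus_def\<close>)

text \<open>With \<open>submodule_span_least\<close> or \<open>spanD\<close> this reduces the claim
  that \<open>f\<close> maps a whole span into \<open>H\<close> to the generators. Many extension
  arguments below have this shape.\<close>

lemma submodule_vimage:
  assumes "module K M" "module K N" "f \<in> linear_maps K M N" "submodule H K N"
  shows "submodule {x \<in> carrier M. f x \<in> H} K M"
proof -
  interpret M: module K M by fact
  show ?thesis
    using submoduleD[OF assms(2,4)]
    by (intro submoduleI' assms)
      (auto simp: linear_maps_zero[OF assms(1-3)] linear_maps_add[OF assms(3)] linear_maps_smult[OF assms(3)])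
qed

lemma submodule_equalizer:
  assumes "module K M" "module K N" "f \<in> linear_maps K M N" "g \<in> linear_maps K M N"
  shows "submodule {x \<in> carrier M. f x = g x} K M"
proof -
  interpret M: module K M by fact
  show ?thesis
    by (intro submoduleI' assms(1))
      (auto simp: linear_maps_zero[OF assms(1,2)] linear_maps_add[OF assms(3)] linear_maps_add[OF assms(4)]
        linear_maps_smult[OF assms(3)] linear_maps_smult[OF assms(4)] assms(3,4))
qed

lemma submodule_zero:
  assumes "module K M"
  shows "submodule {\<zero>\<^bsub>M\<^esub>} K M"
proof -
  interpret M: module K M by fact
  show ?thesis by (intro submoduleI' assms) auto
qed

lemma submodule_span_base: "r \<in> R \<Longrightarrow> r \<in> submodule_span K M R"
  by (auto simp: submodule_span_def)

lemma submodule_span_least: "submodule H K M \<Longrightarrow> R \<subseteq> H \<Longrightarrow> submodule_span K M R \<subseteq> H"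
  by (auto simp: submodule_span_def)

lemma submodule_submodule_span:
  assumes "module K M" "R \<subseteq> carrier M"
  shows "submodule (submodule_span K M R) K M"
proof -
  interpret M: module K M by fact
  have "submodule_span K M R \<subseteq> carrier M"
    using assms(2) M.carrier_is_submodule by (rule submodule_span_least[rotated])
  then show ?thesis
    by (intro submoduleI' assms) (auto simp: submodule_span_def submoduleD[OF assms(1)])
qed

lemma submodule_span_induct [consumes 3, case_names zero base add smult]:
  assumes "module K M" "submodule_span K M G = carrier M" "x \<in> carrier M"
    and "P \<zero>\<^bsub>M\<^esub>" "\<And>g. g \<in> G \<Longrightarrow> P g"
    and "\<And>x y. x \<in> carrier M \<Longrightarrow> y \<in> carrier M \<Longrightarrow> P x \<Longrightarrow> P y \<Longrightarrow> P (x \<oplus>\<^bsub>M\<^esub> y)"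
    and "\<And>c x. c \<in> carrier K \<Longrightarrow> x \<in> carrier M \<Longrightarrow> P x \<Longrightarrow> P (c \<odot>\<^bsub>M\<^esub> x)"
  shows "P x"
proof -
  interpret M: module K M by fact
  have "G \<subseteq> carrier M" using submodule_span_base[of _ G K M] unfolding assms(2) by blast
  then have "G \<subseteq> {x \<in> carrier M. P x}" using assms(5) by blast
  moreover have "submodule {x \<in> carrier M. P x} K M"
  proof (rule submoduleI'[OF assms(1)])
    show "a \<oplus>\<^bsub>M\<^esub> b \<in> {x \<in> carrier M. P x}"
      if "a \<in> {x \<in> carrier M. P x}" "b \<in> {x \<in> carrier M. P x}" for a b
      using that assms(6)[of a b] by simp
    show "c \<odot>\<^bsub>M\<^esub> a \<in> {x \<in> carrier M. P x}"
      if "c \<in> carrier K" "a \<in> {x \<in> carrier M. P x}" for c a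
      using that assms(7)[of c a] by simp
  qed (simp_all add: \<open>P \<zero>\<^bsub>M\<^esub>\<close>)
  ultimately have "submodule_span K M G \<subseteq> {x \<in> carrier M. P x}"
    by (intro submodule_span_least)
  then show ?thesis using assms(2,3) by blast
qed

text \<open>Used for well-definedness on quotients: a linear map that kills the relations kills
  everything they span.\<close>

lemma linear_maps_vanish_on_span:
  assumes "module K M" "module K N" "f \<in> linear_maps K M N"
    and "\<And>r. r \<in> R \<Longrightarrow> r \<in> carrier M" "\<And>r. r \<in> R \<Longrightarrow> f r = \<zero>\<^bsub>N\<^esub>" "x \<in> submodule_span K M R"
  shows "f x = \<zero>\<^bsub>N\<^esub>"
proof -
  have "submodule_span K M R \<subseteq> {x \<in> carrier M. f x \<in> {\<zero>\<^bsub>N\<^esub>}}"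
    using assms(4,5) by (intro submodule_span_least submodule_vimage[OF assms(1-3)] submodule_zero assms(2)) auto
  then show ?thesis using assms(6) by auto
qed

lemma linear_maps_eq_on_span:
  assumes "module K M" "submodule_span K M G = carrier M"
    and fg: "f \<in> linear_maps K M N" "g \<in> linear_maps K M N" and "module K N"
    and eq: "\<And>x. x \<in> G \<Longrightarrow> f x = g x" and "x \<in> carrier M"
  shows "f x = g x"
  using assms(1,2) \<open>x \<in> carrier M\<close>
  by (induction x rule: submodule_span_induct)
    (simp_all add: eq linear_maps_zero[OF assms(1) \<open>module K N\<close>] linear_maps_add[OF fg(1)]
      linear_maps_add[OF fg(2)] linear_maps_smult[OF fg(1)] linear_maps_smult[OF fg(2)] fg)

text \<open>Spanning is expressed through the submodules that contain \<open>G\<close> instead of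
  linear combinations; \<open>spanD\<close> is the converse direction.\<close>

lemma spanI:
  assumes "module K M" "G \<subseteq> carrier M" "\<And>H. submodule H K M \<Longrightarrow> G \<subseteq> H \<Longrightarrow> carrier M \<subseteq> H"
  shows "submodule_span K M G = carrier M"
proof
  note sub = submodule_submodule_span[OF assms(1,2)]
  show "submodule_span K M G \<subseteq> carrier M" by (rule submoduleD(1)[OF assms(1) sub])
  show "carrier M \<subseteq> submodule_span K M G"
    by (rule assms(3)[OF sub]) (blast intro: submodule_span_base)
qed

lemma spanD: "submodule_span K M G = carrier M \<Longrightarrow> submodule H K M \<Longrightarrow> G \<subseteq> H \<Longrightarrow> carrier M \<subseteq> H"
  using submodule_span_least by metis

section \<open>Free modules\<close>

lemma free_module_sel:
  "carrier (free_module K S) = {f. (\<forall>x\<in>S. f x \<in> carrier K) \<and> (\<forall>x. x \<notin> S \<longrightarrow> f x = \<zero>\<^bsub>K\<^esub>) \<and>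
        finite {x. f x \<noteq> \<zero>\<^bsub>K\<^esub>}}"
  "zero (free_module K S) = (\<lambda>_. \<zero>\<^bsub>K\<^esub>)"
  "add (free_module K S) f g = (\<lambda>x. f x \<oplus>\<^bsub>K\<^esub> g x)"
  "smult (free_module K S) c f = (\<lambda>x. c \<otimes>\<^bsub>K\<^esub> f x)"
  by (simp_all add: free_module_def)

lemma module_free_module:
  assumes "cring K"
  shows "module K (free_module K S)"
proof -
  interpret K: cring K by fact
  let ?F = "free_module K S"
  have car: "f x \<in> carrier K" if "f \<in> carrier ?F" for f x
    using that by (cases "x \<in> S") (auto simp: free_module_sel)
  have closed: "f \<oplus>\<^bsub>?F\<^esub> g \<in> carrier ?F" if "f \<in> carrier ?F" "g \<in> carrier ?F" for f g
  proof -
    have "{x. f x \<oplus>\<^bsub>K\<^esub> g x \<noteq> \<zero>\<^bsub>K\<^esub>} \<subseteq> {x. f x \<noteq> \<zero>\<^bsub>K\<^esub>} \<union> {x. g x \<noteq> \<zero>\<^bsub>K\<^esub>}" by auto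
    then show ?thesis using that by (auto simp: free_module_sel intro: finite_subset)
  qed
  have sclosed: "c \<odot>\<^bsub>?F\<^esub> f \<in> carrier ?F" if "f \<in> carrier ?F" "c \<in> carrier K" for f c
  proof -
    have "{x. c \<otimes>\<^bsub>K\<^esub> f x \<noteq> \<zero>\<^bsub>K\<^esub>} \<subseteq> {x. f x \<noteq> \<zero>\<^bsub>K\<^esub>}" using that by auto
    then show ?thesis using that by (auto simp: free_module_sel intro: finite_subset)
  qed
  have inv: "\<exists>g\<in>carrier ?F. g \<oplus>\<^bsub>?F\<^esub> f = \<zero>\<^bsub>?F\<^esub>" if "f \<in> carrier ?F" for f
    using sclosed[OF that, of "\<ominus>\<^bsub>K\<^esub> \<one>\<^bsub>K\<^esub>"] car[OF that]
    by (intro bexI[of _ "(\<ominus>\<^bsub>K\<^esub> \<one>\<^bsub>K\<^esub>) \<odot>\<^bsub>?F\<^esub> f"])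
      (auto simp: free_module_sel K.l_minus K.l_neg)
  show ?thesis
    using car closed sclosed inv
    by (intro moduleI abelian_groupI assms)
     \<comment> \<open>The carrier is unfolded only at the zero function, so that the closure facts
       for the other elements stay applicable.\<close>
     (auto simp: free_module_sel(2-) K.a_ac K.l_distr K.r_distr K.m_assoc free_module_sel(1)[of K S, THEN eqset_imp_iff, of "\<lambda>_. \<zero>\<^bsub>K\<^esub>"])
qed

lemma free_module_app:
  "cring K \<Longrightarrow> f \<in> carrier (free_module K S) \<Longrightarrow> f x \<in> carrier K"
  by (cases "x \<in> S") (auto simp: free_module_sel cring_def ring.ring_simprules)

lemma delta_fun_closed:
  assumes "cring K" "s \<in> S"
  shows "delta_fun K s \<in> carrier (free_module K S)"
proof -
  interpret K: cring K by fact
  have "{x. delta_fun K s x \<noteq> \<zero>\<^bsub>K\<^esub>} \<subseteq> {s}" by (auto simp: delta_fun_def)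
  then show ?thesis using assms(2) by (auto simp: free_module_sel delta_fun_def intro: finite_subset)
qed

lemma span_delta_fun:
  assumes "cring K"
  shows "submodule_span K (free_module K S) (delta_fun K ` S) = carrier (free_module K S)"
proof (rule spanI)
  interpret K: cring K by fact
  show "module K (free_module K S)" by (rule module_free_module[OF assms])
  show "delta_fun K ` S \<subseteq> carrier (free_module K S)" using delta_fun_closed[OF assms] by auto
  fix H assume H: "submodule H K (free_module K S)" "delta_fun K ` S \<subseteq> H"
  note H' = submoduleD[OF module_free_module[OF assms] H(1)]
  \<comment> \<open>Induction on a finite set \<open>A\<close> that contains the support, not on the
    support itself: a point outside \<open>S\<close> can then be dropped at once, since
    \<open>f\<close> vanishes there.\<close>
  have "f \<in> H" if "finite A" "f \<in> carrier (free_module K S)" "{x. f x \<noteq> \<zero>\<^bsub>K\<^esub>} \<subseteq> A" for A f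
    using that
  proof (induction A arbitrary: f rule: finite_induct)
    case empty
    then have "f = \<zero>\<^bsub>free_module K S\<^esub>" by (auto simp: free_module_sel)
    then show ?case using H'(2) by simp
  next
    case (insert a A)
    show ?case
    proof (cases "a \<in> S")
      case True
      let ?g = "f(a := \<zero>\<^bsub>K\<^esub>)"
      have "finite {x. ?g x \<noteq> \<zero>\<^bsub>K\<^esub>}"
        by (rule finite_subset[of _ A]) (use insert in auto)
      then have g: "?g \<in> carrier (free_module K S)" using insert.prems(1) by (auto simp: free_module_sel)
      then have "?g \<in> H" by (rule insert.IH) (use insert in auto)
      moreover have "f a \<odot>\<^bsub>free_module K S\<^esub> delta_fun K a \<in> H"
        using H True free_module_app[OF assms insert.prems(1)] by (intro H') auto
      moreover have "f = ?g \<oplus>\<^bsub>free_module K S\<^esub> f a \<odot>\<^bsub>free_module K S\<^esub> delta_fun K a"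
        using free_module_app[OF assms insert.prems(1)] by (auto simp: free_module_sel delta_fun_def)
      ultimately show ?thesis using H'(3) by metis
    next
      case False
      then show ?thesis using insert.prems insert.IH[of f] by (auto simp: free_module_sel)
    qed
  qed
  then show "carrier (free_module K S) \<subseteq> H" by (force simp: free_module_sel)
qed

lemma free_module_universal:
  assumes "cring K" "module K M" "\<And>s. s \<in> S \<Longrightarrow> u s \<in> carrier M"
  obtains f where "f \<in> linear_maps K (free_module K S) M" "\<And>s. s \<in> S \<Longrightarrow> f (delta_fun K s) = u s"
proof -
  interpret K: cring K by fact
  interpret M: module K M by fact
  interpret F: module K "free_module K S" by (rule module_free_module[OF assms(1)])
  define l where "l f = (\<Oplus>\<^bsub>M\<^esub>x\<in>{x. f x \<noteq> \<zero>\<^bsub>K\<^esub>}. f x \<odot>\<^bsub>M\<^esub> u x)" for f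
  \<comment> \<open>The sum in \<open>l\<close> runs over the support, which changes under addition
    and scaling. Enlarging it to any finite \<open>A\<close> between the support and
    \<open>S\<close> lets both sides of an equation share one index set.\<close>
  have l: "l f = (\<Oplus>\<^bsub>M\<^esub>x\<in>A. f x \<odot>\<^bsub>M\<^esub> u x)"
    if "finite A" "A \<subseteq> S" "{x. f x \<noteq> \<zero>\<^bsub>K\<^esub>} \<subseteq> A" "f \<in> carrier (free_module K S)" for A f
    unfolding l_def using that assms(3) free_module_app[OF assms(1) that(4)]
    by (intro M.M.add.finprod_mono_neutral_cong_left) auto
  have supp: "finite {x. f x \<noteq> \<zero>\<^bsub>K\<^esub>}" "{x. f x \<noteq> \<zero>\<^bsub>K\<^esub>} \<subseteq> S" if "f \<in> carrier (free_module K S)" for f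
    using that by (auto simp: free_module_sel)
  have "l \<in> linear_maps K (free_module K S) M"
  proof (rule linear_mapsI)
    fix f assume f: "f \<in> carrier (free_module K S)"
    show "l f \<in> carrier M"
      unfolding l_def using supp[OF f] assms(3) free_module_app[OF assms(1) f]
      by (intro M.M.finsum_closed) auto
  next
    fix f g assume f: "f \<in> carrier (free_module K S)" and g: "g \<in> carrier (free_module K S)"
    let ?A = "{x. f x \<noteq> \<zero>\<^bsub>K\<^esub>} \<union> {x. g x \<noteq> \<zero>\<^bsub>K\<^esub>}"
    note * = supp[OF f] supp[OF g] free_module_app[OF assms(1) f] free_module_app[OF assms(1) g] assms(3)
    have "l (f \<oplus>\<^bsub>free_module K S\<^esub> g) = (\<Oplus>\<^bsub>M\<^esub>x\<in>?A. (f \<oplus>\<^bsub>free_module K S\<^esub> g) x \<odot>\<^bsub>M\<^esub> u x)"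
      by (rule l) (use f g F.M.a_closed[OF f g] * in \<open>auto simp: free_module_sel(3)\<close>)
    also have "\<dots> = (\<Oplus>\<^bsub>M\<^esub>x\<in>?A. f x \<odot>\<^bsub>M\<^esub> u x \<oplus>\<^bsub>M\<^esub> g x \<odot>\<^bsub>M\<^esub> u x)"
      by (rule M.M.finsum_cong') (use * in \<open>auto simp: free_module_sel(3) M.smult_l_distr subset_iff\<close>)
    also have "\<dots> = l f \<oplus>\<^bsub>M\<^esub> l g"
    proof -
      have "l f = (\<Oplus>\<^bsub>M\<^esub>x\<in>?A. f x \<odot>\<^bsub>M\<^esub> u x)" "l g = (\<Oplus>\<^bsub>M\<^esub>x\<in>?A. g x \<odot>\<^bsub>M\<^esub> u x)"
        using * f g by (intro l; blast)+
      then show ?thesis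
        using * by (simp only:) (intro M.M.finsum_addf; blast)
    qed
    finally show "l (f \<oplus>\<^bsub>free_module K S\<^esub> g) = l f \<oplus>\<^bsub>M\<^esub> l g" .
  next
    fix c f assume c: "c \<in> carrier K" and f: "f \<in> carrier (free_module K S)"
    let ?A = "{x. f x \<noteq> \<zero>\<^bsub>K\<^esub>}"
    note * = supp[OF f] free_module_app[OF assms(1) f] assms(3)
    have "l (c \<odot>\<^bsub>free_module K S\<^esub> f) = (\<Oplus>\<^bsub>M\<^esub>x\<in>?A. (c \<odot>\<^bsub>free_module K S\<^esub> f) x \<odot>\<^bsub>M\<^esub> u x)"
      using * c by (intro l F.smult_closed[OF c f]) (auto simp: free_module_sel(4))
    also have "\<dots> = (\<Oplus>\<^bsub>M\<^esub>x\<in>?A. c \<odot>\<^bsub>M\<^esub> (f x \<odot>\<^bsub>M\<^esub> u x))"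
      by (rule M.M.finsum_cong') (use * c in \<open>auto simp: free_module_sel(4) M.smult_assoc1 subset_iff\<close>)
    also have "\<dots> = c \<odot>\<^bsub>M\<^esub> l f"
      unfolding l_def using * c by (intro M.finsum_smult_ldistr[symmetric]) auto
    finally show "l (c \<odot>\<^bsub>free_module K S\<^esub> f) = c \<odot>\<^bsub>M\<^esub> l f" .
  qed
  moreover have "l (delta_fun K s) = u s" if "s \<in> S" for s
  proof -
    have "l (delta_fun K s) = (\<Oplus>\<^bsub>M\<^esub>x\<in>{s}. delta_fun K s x \<odot>\<^bsub>M\<^esub> u x)"
      using that delta_fun_closed[OF assms(1) that] by (intro l) (auto simp: delta_fun_def)
    then show ?thesis using assms(3)[OF that] by (simp add: delta_fun_def)
  qed
  ultimately show thesis using that by blast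
qed

section \<open>Quotients\<close>

context
  fixes K :: "('k, 'm) ring_scheme" and M :: "('k, 'a, 'n) module_scheme" and N :: "'a set"
  assumes M: "module K M" and N: "submodule N K M"
begin

interpretation M: module K M by (rule M)

interpretation N: abelian_subgroup N M
  using submodule.axioms(1)[OF N] by (intro abelian_subgroupI3 additive_subgroupI M.M.abelian_group_axioms)

text \<open>This turns each defining relation into an equation of classes; bilinearity of
  \<open>pure_tensor\<close> and multilinearity of \<open>tensor_word\<close> are obtained in this
  way.\<close>

lemma coset_eq_iff:
  assumes "a \<in> carrier M" "b \<in> carrier M"
  shows "N +>\<^bsub>M\<^esub> a = N +>\<^bsub>M\<^esub> b \<longleftrightarrow> a \<ominus>\<^bsub>M\<^esub> b \<in> N"
proof
  assume "N +>\<^bsub>M\<^esub> a = N +>\<^bsub>M\<^esub> b"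
  then have "a \<in> N +>\<^bsub>M\<^esub> b" using N.a_rcos_self[OF assms(1)] by simp
  then show "a \<ominus>\<^bsub>M\<^esub> b \<in> N" using N.a_rcos_module_imp[OF assms(2)] by (simp add: a_minus_def)
next
  assume "a \<ominus>\<^bsub>M\<^esub> b \<in> N"
  then have "a \<in> N +>\<^bsub>M\<^esub> b" using N.a_rcos_module_rev[OF assms(2,1)] by (simp add: a_minus_def)
  then show "N +>\<^bsub>M\<^esub> a = N +>\<^bsub>M\<^esub> b"
    using M.M.a_repr_independence[OF _ assms(2) submodule.axioms(1)[OF N]] by simp
qed

lemma coset_memD:
  assumes "a \<in> carrier M" "b \<in> N +>\<^bsub>M\<^esub> a"
  shows "b \<in> carrier M" "N +>\<^bsub>M\<^esub> b = N +>\<^bsub>M\<^esub> a"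
  using N.a_elemrcos_carrier[OF assms] M.M.a_repr_independence[OF assms(2,1) submodule.axioms(1)[OF N]] by simp_all

lemma quot_module_carrier: "carrier (quot_module M N) = (\<lambda>a. N +>\<^bsub>M\<^esub> a) ` carrier M"
  by (auto simp: quot_module_def A_RCOSETS_def' a_r_coset_def')

lemma quot_module_zero: "\<zero>\<^bsub>quot_module M N\<^esub> = N +>\<^bsub>M\<^esub> \<zero>\<^bsub>M\<^esub>"
  using N.a_rcos_const[OF N.zero_closed] by (simp add: quot_module_def)

lemma quot_module_add:
  "a \<in> carrier M \<Longrightarrow> b \<in> carrier M \<Longrightarrow>
    (N +>\<^bsub>M\<^esub> a) \<oplus>\<^bsub>quot_module M N\<^esub> (N +>\<^bsub>M\<^esub> b) = N +>\<^bsub>M\<^esub> (a \<oplus>\<^bsub>M\<^esub> b)"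
  by (simp add: quot_module_def N.a_rcos_sum)

text \<open>Scaling of a coset is defined as a union over all its representatives. The union is a
  single coset because \<open>N\<close> is closed under scaling, so that all representatives give
  the same one.\<close>

lemma quot_module_smult:
  assumes "c \<in> carrier K" "a \<in> carrier M"
  shows "c \<odot>\<^bsub>quot_module M N\<^esub> (N +>\<^bsub>M\<^esub> a) = N +>\<^bsub>M\<^esub> (c \<odot>\<^bsub>M\<^esub> a)"
proof -
  have "N +>\<^bsub>M\<^esub> (c \<odot>\<^bsub>M\<^esub> b) = N +>\<^bsub>M\<^esub> (c \<odot>\<^bsub>M\<^esub> a)" if "b \<in> N +>\<^bsub>M\<^esub> a" for b
  proof -
    note b = coset_memD[OF assms(2) that]
    have "b \<ominus>\<^bsub>M\<^esub> a \<in> N" using b assms(2) by (simp add: coset_eq_iff)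
    then have "c \<odot>\<^bsub>M\<^esub> (b \<ominus>\<^bsub>M\<^esub> a) \<in> N" by (rule submoduleD(5)[OF M N assms(1)])
    then show ?thesis using assms b(1)
      by (simp add: coset_eq_iff a_minus_def M.smult_r_distr M.smult_r_minus)
  qed
  then have "(\<Union>b\<in>N +>\<^bsub>M\<^esub> a. N +>\<^bsub>M\<^esub> (c \<odot>\<^bsub>M\<^esub> b)) = (\<Union>b\<in>N +>\<^bsub>M\<^esub> a. N +>\<^bsub>M\<^esub> (c \<odot>\<^bsub>M\<^esub> a))"
    by (intro SUP_cong refl)
  also have "\<dots> = N +>\<^bsub>M\<^esub> (c \<odot>\<^bsub>M\<^esub> a)"
    using N.a_rcos_self[OF assms(2)] by blast
  finally show ?thesis by (simp add: quot_module_def)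
qed

lemma module_quot_module: "module K (quot_module M N)"
proof (intro moduleI abelian_groupI)
  fix x assume "x \<in> carrier (quot_module M N)"
  then obtain a where a: "a \<in> carrier M" "x = N +>\<^bsub>M\<^esub> a" by (auto simp: quot_module_carrier)
  then show "\<exists>y\<in>carrier (quot_module M N). y \<oplus>\<^bsub>quot_module M N\<^esub> x = \<zero>\<^bsub>quot_module M N\<^esub>"
    by (intro bexI[of _ "N +>\<^bsub>M\<^esub> (\<ominus>\<^bsub>M\<^esub> a)"])
      (auto simp: quot_module_carrier quot_module_zero quot_module_add M.M.l_neg)
qed (auto simp: quot_module_carrier quot_module_zero quot_module_add quot_module_smult M.M.a_ac
    M.smult_l_distr M.smult_r_distr M.smult_assoc1 M.R.cring_axioms)

lemma linear_maps_coset: "(\<lambda>a. N +>\<^bsub>M\<^esub> a) \<in> linear_maps K M (quot_module M N)"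
  by (intro linear_mapsI) (auto simp: quot_module_carrier quot_module_add quot_module_smult)

lemma span_quot_module:
  assumes "submodule_span K M G = carrier M"
  shows "submodule_span K (quot_module M N) ((\<lambda>a. N +>\<^bsub>M\<^esub> a) ` G) = carrier (quot_module M N)"
proof (rule spanI[OF module_quot_module])
  have G: "G \<subseteq> carrier M" using submodule_span_base[of _ G K M] unfolding assms by blast
  then show "(\<lambda>a. N +>\<^bsub>M\<^esub> a) ` G \<subseteq> carrier (quot_module M N)" by (auto simp: quot_module_carrier)
  fix H assume H: "submodule H K (quot_module M N)" "(\<lambda>a. N +>\<^bsub>M\<^esub> a) ` G \<subseteq> H"
  have "carrier M \<subseteq> {a \<in> carrier M. N +>\<^bsub>M\<^esub> a \<in> H}"
    using G H(2)
    by (intro spanD[OF assms] submodule_vimage[OF M module_quot_module linear_maps_coset H(1)]) auto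
  then show "carrier (quot_module M N) \<subseteq> H" by (auto simp: quot_module_carrier)
qed

lemma quot_module_universal:
  assumes "f \<in> linear_maps K M P" "module K P" "\<And>n. n \<in> N \<Longrightarrow> f n = \<zero>\<^bsub>P\<^esub>"
  obtains g where "g \<in> linear_maps K (quot_module M N) P" "\<And>a. a \<in> carrier M \<Longrightarrow> g (N +>\<^bsub>M\<^esub> a) = f a"
proof -
  interpret P: module K P by fact
  \<comment> \<open>A representative is chosen for each coset. The choice does not matter, because
    two of them differ by an element of \<open>N\<close>, where \<open>f\<close> vanishes.\<close>
  define g where "g C = f (SOME a. a \<in> carrier M \<and> C = N +>\<^bsub>M\<^esub> a)" for C
  have g: "g (N +>\<^bsub>M\<^esub> a) = f a" if a: "a \<in> carrier M" for a
  proof -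
    define b where "b = (SOME b. b \<in> carrier M \<and> N +>\<^bsub>M\<^esub> a = N +>\<^bsub>M\<^esub> b)"
    have b: "b \<in> carrier M" "N +>\<^bsub>M\<^esub> a = N +>\<^bsub>M\<^esub> b"
      using someI[of "\<lambda>b. b \<in> carrier M \<and> N +>\<^bsub>M\<^esub> a = N +>\<^bsub>M\<^esub> b" a] a by (auto simp: b_def)
    then have "f (a \<ominus>\<^bsub>M\<^esub> b) = \<zero>\<^bsub>P\<^esub>" using assms(3) a by (simp add: coset_eq_iff)
    then have "f a \<ominus>\<^bsub>P\<^esub> f b = \<zero>\<^bsub>P\<^esub>" by (simp add: linear_maps_minus[OF M assms(2,1) a b(1)])
    then have "f a = f b"
      using linear_maps_closed[OF assms(1)] a b(1)
      by (metis P.M.add.inv_solve_right P.M.l_zero P.M.minus_eq P.M.zero_closed)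
    then show ?thesis by (simp add: g_def b_def)
  qed
  have "g \<in> linear_maps K (quot_module M N) P"
    using linear_maps_closed[OF assms(1)] linear_maps_add[OF assms(1)] linear_maps_smult[OF assms(1)]
    by (intro linear_mapsI) (auto simp: quot_module_carrier g quot_module_add quot_module_smult)
  then show thesis using g that by blast
qed

text \<open>The product is a union over all pairs of representatives. Replacing first
  \<open>a'\<close> by \<open>a\<close> and then \<open>b'\<close> by \<open>b\<close> changes the
  product by an element of \<open>N\<close> each time, by the two ideal conditions, so only one
  coset occurs.\<close>

lemma quot_module_mult:
  assumes "nonunital_algebra K M"
    and ideal: "\<And>a n. a \<in> carrier M \<Longrightarrow> n \<in> N \<Longrightarrow> a \<otimes>\<^bsub>M\<^esub> n \<in> N" "\<And>a n. a \<in> carrier M \<Longrightarrow> n \<in> N \<Longrightarrow> n \<otimes>\<^bsub>M\<^esub> a \<in> N"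
    and ab: "a \<in> carrier M" "b \<in> carrier M"
  shows "(N +>\<^bsub>M\<^esub> a) \<otimes>\<^bsub>quot_module M N\<^esub> (N +>\<^bsub>M\<^esub> b) = N +>\<^bsub>M\<^esub> (a \<otimes>\<^bsub>M\<^esub> b)"
proof -
  interpret A: nonunital_algebra K M by fact
  have "N +>\<^bsub>M\<^esub> (a' \<otimes>\<^bsub>M\<^esub> b') = N +>\<^bsub>M\<^esub> (a \<otimes>\<^bsub>M\<^esub> b)"
    if a': "a' \<in> N +>\<^bsub>M\<^esub> a" and b': "b' \<in> N +>\<^bsub>M\<^esub> b" for a' b'
  proof -
    note a'' = coset_memD[OF ab(1) a'] and b'' = coset_memD[OF ab(2) b']
    have "(a' \<ominus>\<^bsub>M\<^esub> a) \<otimes>\<^bsub>M\<^esub> b' \<in> N" using a'' b'' ab by (intro ideal) (simp_all add: coset_eq_iff)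
    then have 1: "N +>\<^bsub>M\<^esub> (a' \<otimes>\<^bsub>M\<^esub> b') = N +>\<^bsub>M\<^esub> (a \<otimes>\<^bsub>M\<^esub> b')"
      using a''(1) b''(1) ab
      by (simp add: coset_eq_iff A.mult_closed linear_maps_minus[OF M M A.mult_linear(1)])
    have "a \<otimes>\<^bsub>M\<^esub> (b' \<ominus>\<^bsub>M\<^esub> b) \<in> N" using a'' b'' ab by (intro ideal) (simp_all add: coset_eq_iff)
    then have 2: "N +>\<^bsub>M\<^esub> (a \<otimes>\<^bsub>M\<^esub> b') = N +>\<^bsub>M\<^esub> (a \<otimes>\<^bsub>M\<^esub> b)"
      using a''(1) b''(1) ab
      by (simp add: coset_eq_iff A.mult_closed linear_maps_minus[OF M M A.mult_linear(2)])
    show ?thesis using 1 2 by simp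
  qed
  then have "rcoset_mult M N (N +>\<^bsub>M\<^esub> a) (N +>\<^bsub>M\<^esub> b) =
      (\<Union>a'\<in>N +>\<^bsub>M\<^esub> a. \<Union>b'\<in>N +>\<^bsub>M\<^esub> b. N +>\<^bsub>M\<^esub> (a \<otimes>\<^bsub>M\<^esub> b))"
    unfolding rcoset_mult_def by (intro SUP_cong refl)
  also have "\<dots> = N +>\<^bsub>M\<^esub> (a \<otimes>\<^bsub>M\<^esub> b)"
    using N.a_rcos_self[OF ab(1)] N.a_rcos_self[OF ab(2)] by blast
  finally show ?thesis by (simp add: quot_module_def)
qed

lemma nonunital_algebra_quot_module:
  assumes "nonunital_algebra K M"
    and ideal: "\<And>a n. a \<in> carrier M \<Longrightarrow> n \<in> N \<Longrightarrow> a \<otimes>\<^bsub>M\<^esub> n \<in> N" "\<And>a n. a \<in> carrier M \<Longrightarrow> n \<in> N \<Longrightarrow> n \<otimes>\<^bsub>M\<^esub> a \<in> N"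
  shows "nonunital_algebra K (quot_module M N)"
proof -
  interpret A: nonunital_algebra K M by fact
  interpret Q: module K "quot_module M N" by (rule module_quot_module)
  note [simp] = quot_module_mult[OF assms]
  show ?thesis
    by (intro nonunital_algebra.intro module_quot_module nonunital_algebra_axioms.intro)
      (auto simp: quot_module_carrier quot_module_add quot_module_smult A.mult_closed A.mult_assoc
        A.mult_add_left A.mult_add_right A.mult_smult_left A.mult_smult_right)
qed

end

section \<open>Tensor products\<close>

context
  fixes K :: "('k, 'm) ring_scheme" and U :: "('k, 'a, 'n) module_scheme" and V :: "('k, 'b, 'p) module_scheme"
  assumes U: "module K U" and V: "module K V"
begin

interpretation U: module K U by (rule U)
interpretation V: module K V by (rule V)

lemma module_tensor_free: "module K (free_module K (carrier U \<times> carrier V))"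
  by (rule module_free_module[OF U.R.cring_axioms])

interpretation F: module K "free_module K (carrier U \<times> carrier V)" by (rule module_tensor_free)

lemma tensor_delta_closed:
  "u \<in> carrier U \<Longrightarrow> v \<in> carrier V \<Longrightarrow> delta_fun K (u, v) \<in> carrier (free_module K (carrier U \<times> carrier V))"
  by (intro delta_fun_closed U.R.cring_axioms) auto

lemma tensor_rels_closed: "tensor_rels K U V \<subseteq> carrier (free_module K (carrier U \<times> carrier V))"
  unfolding tensor_rels_def Let_def
  by (intro Un_least subsetI; clarify; intro F.M.minus_closed F.M.a_closed F.smult_closed tensor_delta_closed)
    simp_all

lemma submodule_tensor_null: "submodule (tensor_null K U V) K (free_module K (carrier U \<times> carrier V))"
  unfolding tensor_null_def by (rule submodule_submodule_span[OF module_tensor_free tensor_rels_closed])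

lemma module_tensor_product: "module K (tensor_product K U V)"
  unfolding tensor_product_def by (rule module_quot_module[OF module_tensor_free submodule_tensor_null])

lemma tensor_null_rels:
  fixes F e
  defines "F \<equiv> free_module K (carrier U \<times> carrier V)" and "e \<equiv> delta_fun K"
  shows "u \<in> carrier U \<Longrightarrow> u' \<in> carrier U \<Longrightarrow> v \<in> carrier V \<Longrightarrow>
      e (u \<oplus>\<^bsub>U\<^esub> u', v) \<ominus>\<^bsub>F\<^esub> (e (u, v) \<oplus>\<^bsub>F\<^esub> e (u', v)) \<in> tensor_null K U V"
    and "u \<in> carrier U \<Longrightarrow> v \<in> carrier V \<Longrightarrow> v' \<in> carrier V \<Longrightarrow>
      e (u, v \<oplus>\<^bsub>V\<^esub> v') \<ominus>\<^bsub>F\<^esub> (e (u, v) \<oplus>\<^bsub>F\<^esub> e (u, v')) \<in> tensor_null K U V"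
    and "c \<in> carrier K \<Longrightarrow> u \<in> carrier U \<Longrightarrow> v \<in> carrier V \<Longrightarrow>
      e (c \<odot>\<^bsub>U\<^esub> u, v) \<ominus>\<^bsub>F\<^esub> c \<odot>\<^bsub>F\<^esub> e (u, v) \<in> tensor_null K U V"
    and "c \<in> carrier K \<Longrightarrow> u \<in> carrier U \<Longrightarrow> v \<in> carrier V \<Longrightarrow>
      e (u, c \<odot>\<^bsub>V\<^esub> v) \<ominus>\<^bsub>F\<^esub> c \<odot>\<^bsub>F\<^esub> e (u, v) \<in> tensor_null K U V"
  unfolding tensor_null_def tensor_rels_def Let_def F_def e_def
  by (rule submodule_span_base, blast)+

lemmas tensor_coset =
  quot_module_carrier[OF module_tensor_free submodule_tensor_null]
  quot_module_add[OF module_tensor_free submodule_tensor_null]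
  quot_module_smult[OF module_tensor_free submodule_tensor_null]
  coset_eq_iff[OF module_tensor_free submodule_tensor_null]

lemma pure_tensor_linear_left:
  assumes "v \<in> carrier V"
  shows "(\<lambda>u. pure_tensor K U V u v) \<in> linear_maps K U (tensor_product K U V)"
  unfolding pure_tensor_def tensor_product_def using assms
  by (intro linear_mapsI) (simp_all add: tensor_coset tensor_delta_closed tensor_null_rels)

lemma pure_tensor_linear_right:
  assumes "u \<in> carrier U"
  shows "(\<lambda>v. pure_tensor K U V u v) \<in> linear_maps K V (tensor_product K U V)"
  unfolding pure_tensor_def tensor_product_def using assms
  by (intro linear_mapsI) (simp_all add: tensor_coset tensor_delta_closed tensor_null_rels)

lemma span_pure_tensor:
  "submodule_span K (tensor_product K U V) {pure_tensor K U V u v |u v. u \<in> carrier U \<and> v \<in> carrier V}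
    = carrier (tensor_product K U V)"
proof -
  have "{pure_tensor K U V u v |u v. u \<in> carrier U \<and> v \<in> carrier V} =
    (\<lambda>a. tensor_null K U V +>\<^bsub>free_module K (carrier U \<times> carrier V)\<^esub> a) ` delta_fun K ` (carrier U \<times> carrier V)"
    by (auto simp: pure_tensor_def)
  then show ?thesis
    unfolding tensor_product_def
    using span_quot_module[OF module_tensor_free submodule_tensor_null span_delta_fun[OF U.R.cring_axioms]]
    by simp
qed

text \<open>Hypotheses \<open>l\<close> and \<open>r\<close> together say that \<open>b\<close> is
  bilinear. Its linear extension to the free vector space then kills each of the four families in
  \<open>tensor_rels\<close>, and so descends to the quotient.\<close>

lemma tensor_product_universal:
  assumes P: "module K P"
    and l: "\<And>v. v \<in> carrier V \<Longrightarrow> (\<lambda>u. b u v) \<in> linear_maps K U P"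
    and r: "\<And>u. u \<in> carrier U \<Longrightarrow> (\<lambda>v. b u v) \<in> linear_maps K V P"
  obtains f where "f \<in> linear_maps K (tensor_product K U V) P"
    "\<And>u v. u \<in> carrier U \<Longrightarrow> v \<in> carrier V \<Longrightarrow> f (pure_tensor K U V u v) = b u v"
proof -
  obtain f0 where f0: "f0 \<in> linear_maps K (free_module K (carrier U \<times> carrier V)) P"
    "\<And>s. s \<in> carrier U \<times> carrier V \<Longrightarrow> f0 (delta_fun K s) = (\<lambda>(u, v). b u v) s"
    by (rule free_module_universal[OF U.R.cring_axioms P, of "carrier U \<times> carrier V" "\<lambda>(u, v). b u v"])
      (use linear_maps_closed[OF l] in auto)
  note f0' = f0(2)[of "(u, v)" for u v, simplified]
  have "f0 r = \<zero>\<^bsub>P\<^esub>" if "r \<in> tensor_rels K U V" for r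
    using that
    by (auto simp: tensor_rels_def Let_def linear_maps_add[OF f0(1)] linear_maps_smult[OF f0(1)] f0' tensor_delta_closed
        linear_maps_add[OF l] linear_maps_add[OF r] linear_maps_smult[OF l] linear_maps_smult[OF r]
        intro!: linear_maps_minus_eq_zero[OF module_tensor_free P f0(1)])
  then have null: "f0 n = \<zero>\<^bsub>P\<^esub>" if "n \<in> tensor_null K U V" for n
    using linear_maps_vanish_on_span[OF module_tensor_free P f0(1)] tensor_rels_closed that
    unfolding tensor_null_def by blast
  obtain f where f: "f \<in> linear_maps K (tensor_product K U V) P"
    "\<And>a. a \<in> carrier (free_module K (carrier U \<times> carrier V)) \<Longrightarrow>
      f (tensor_null K U V +>\<^bsub>free_module K (carrier U \<times> carrier V)\<^esub> a) = f0 a"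
    unfolding tensor_product_def
    by (rule quot_module_universal[OF module_tensor_free submodule_tensor_null f0(1) P null]) blast+
  show thesis
    by (rule that[OF f(1)]) (simp add: pure_tensor_def tensor_delta_closed f(2) f0')
qed

end

section \<open>Algebras of words\<close>

text \<open>\<open>word_algebra\<close> differs from \<open>free_module\<close> only in the fields
  \<open>mult\<close> and \<open>one\<close>, on which being a module does not depend. With
  \<open>submodule_cong\<close> this transfers the results on free vector spaces.\<close>

lemma module_cong:
  fixes M M' :: "('k, 'a, 'n) module_scheme"
  assumes "module K M"
    and "carrier M' = carrier M" "\<zero>\<^bsub>M'\<^esub> = \<zero>\<^bsub>M\<^esub>" "(\<oplus>\<^bsub>M'\<^esub>) = (\<oplus>\<^bsub>M\<^esub>)" "(\<odot>\<^bsub>M'\<^esub>) = (\<odot>\<^bsub>M\<^esub>)"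
  shows "module K M'"
proof -
  have "add_monoid M' = add_monoid M" using assms(2-) by simp
  then show ?thesis
    using assms unfolding module_def module_axioms_def abelian_group_def abelian_monoid_def abelian_group_axioms_def
    by simp
qed

lemma submodule_cong:
  fixes M M' :: "('k, 'a, 'n) module_scheme"
  assumes "carrier M' = carrier M" "\<zero>\<^bsub>M'\<^esub> = \<zero>\<^bsub>M\<^esub>" "(\<oplus>\<^bsub>M'\<^esub>) = (\<oplus>\<^bsub>M\<^esub>)" "(\<odot>\<^bsub>M'\<^esub>) = (\<odot>\<^bsub>M\<^esub>)"
  shows "submodule H K M' \<longleftrightarrow> submodule H K M"
proof -
  have "add_monoid M' = add_monoid M" using assms by simp
  then show ?thesis
    using assms unfolding submodule_def submodule_axioms_def by simp
qed

lemma word_algebra_sel: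
  "carrier (word_algebra K L) = carrier (free_module K L)"
  "\<zero>\<^bsub>word_algebra K L\<^esub> = \<zero>\<^bsub>free_module K L\<^esub>"
  "(\<oplus>\<^bsub>word_algebra K L\<^esub>) = (\<oplus>\<^bsub>free_module K L\<^esub>)"
  "(\<odot>\<^bsub>word_algebra K L\<^esub>) = (\<odot>\<^bsub>free_module K L\<^esub>)"
  "f \<otimes>\<^bsub>word_algebra K L\<^esub> g = (\<lambda>w. \<Oplus>\<^bsub>K\<^esub>i\<in>{..length w}. f (take i w) \<otimes>\<^bsub>K\<^esub> g (drop i w))"
  by (simp_all add: word_algebra_def)

lemma linear_maps_word_algebra: "linear_maps K (word_algebra K L) P = linear_maps K (free_module K L) P"
  by (simp add: linear_maps_def word_algebra_sel)

lemma module_word_algebra: "cring K \<Longrightarrow> module K (word_algebra K L)"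
  by (rule module_cong[OF module_free_module]) (simp_all add: word_algebra_sel)

lemma delta_fun_word_closed: "cring K \<Longrightarrow> w \<in> L \<Longrightarrow> delta_fun K w \<in> carrier (word_algebra K L)"
  by (simp add: word_algebra_sel delta_fun_closed)

lemma span_word_algebra:
  assumes "cring K"
  shows "submodule_span K (word_algebra K L) (delta_fun K ` L) = carrier (word_algebra K L)"
proof -
  have "submodule H K (word_algebra K L) \<longleftrightarrow> submodule H K (free_module K L)" for H
    by (rule submodule_cong) (simp_all add: word_algebra_sel)
  then have "submodule_span K (word_algebra K L) (delta_fun K ` L) = submodule_span K (free_module K L) (delta_fun K ` L)"
    by (simp add: submodule_span_def)
  then show ?thesis by (simp add: span_delta_fun[OF assms] word_algebra_sel)
qed

context
  fixes K :: "('k, 'm) ring_scheme" and L :: "'x list set"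
  assumes K: "cring K" and append_closed: "\<And>p q. p \<in> L \<Longrightarrow> q \<in> L \<Longrightarrow> p @ q \<in> L"
begin

interpretation K: cring K by (rule K)

lemma word_mult_closed:
  assumes "f \<in> carrier (word_algebra K L)" "g \<in> carrier (word_algebra K L)"
  shows "f \<otimes>\<^bsub>word_algebra K L\<^esub> g \<in> carrier (word_algebra K L)"
proof -
  have f: "f x \<in> carrier K" and g: "g x \<in> carrier K" for x
    using assms free_module_app[OF K] by (auto simp: word_algebra_sel)
  have supp: "f x \<noteq> \<zero>\<^bsub>K\<^esub> \<Longrightarrow> x \<in> L" "g x \<noteq> \<zero>\<^bsub>K\<^esub> \<Longrightarrow> x \<in> L" for x
    using assms by (auto simp: word_algebra_sel free_module_sel)
  let ?P = "f \<otimes>\<^bsub>word_algebra K L\<^esub> g"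
  \<comment> \<open>The product vanishes outside the concatenations of a word in the support of
    \<open>f\<close> with one in the support of \<open>g\<close>. This gives both finiteness of the
    support and its containment in \<open>L\<close>.\<close>
  let ?S = "(\<lambda>(p, q). p @ q) ` ({x. f x \<noteq> \<zero>\<^bsub>K\<^esub>} \<times> {x. g x \<noteq> \<zero>\<^bsub>K\<^esub>})"
  have zero: "?P w = \<zero>\<^bsub>K\<^esub>" if "w \<notin> ?S" for w
  proof -
    have "f (take i w) \<otimes>\<^bsub>K\<^esub> g (drop i w) = \<zero>\<^bsub>K\<^esub>" for i
    proof (cases "f (take i w) = \<zero>\<^bsub>K\<^esub> \<or> g (drop i w) = \<zero>\<^bsub>K\<^esub>")
      case False
      then have "w \<in> ?S"
        by (intro image_eqI[where x = "(take i w, drop i w)"]) simp_all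
      then show ?thesis using that by simp
    qed (use f g in auto)
    then show ?thesis by (simp add: word_algebra_sel)
  qed
  have "?P w \<in> carrier K" for w using f g by (simp add: word_algebra_sel Pi_def)
  moreover have "?P w = \<zero>\<^bsub>K\<^esub>" if "w \<notin> L" for w
    using that supp append_closed by (intro zero) auto
  moreover have "finite {w. ?P w \<noteq> \<zero>\<^bsub>K\<^esub>}"
  proof (rule finite_subset)
    show "{w. ?P w \<noteq> \<zero>\<^bsub>K\<^esub>} \<subseteq> ?S" using zero by blast
    show "finite ?S" using assms by (auto simp: word_algebra_sel free_module_sel)
  qed
  ultimately show ?thesis unfolding word_algebra_sel(1) free_module_sel by blast
qed

lemma word_mult_linear_left:
  assumes "g \<in> carrier (word_algebra K L)"
  shows "(\<lambda>f. f \<otimes>\<^bsub>word_algebra K L\<^esub> g) \<in> linear_maps K (word_algebra K L) (word_algebra K L)"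
proof (rule linear_mapsI)
  note app = free_module_app[OF K, of _ L, folded word_algebra_sel(1)]
  note [simp] = app[OF assms]
  show "f \<otimes>\<^bsub>word_algebra K L\<^esub> g \<in> carrier (word_algebra K L)" if "f \<in> carrier (word_algebra K L)" for f
    using that assms by (rule word_mult_closed)
  show "(f \<oplus>\<^bsub>word_algebra K L\<^esub> f') \<otimes>\<^bsub>word_algebra K L\<^esub> g =
      f \<otimes>\<^bsub>word_algebra K L\<^esub> g \<oplus>\<^bsub>word_algebra K L\<^esub> f' \<otimes>\<^bsub>word_algebra K L\<^esub> g"
    if "f \<in> carrier (word_algebra K L)" "f' \<in> carrier (word_algebra K L)" for f f'
    using app[OF that(1)] app[OF that(2)]
    by (simp add: word_algebra_sel(3,5) free_module_sel K.l_distr Pi_def)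
  show "(c \<odot>\<^bsub>word_algebra K L\<^esub> f) \<otimes>\<^bsub>word_algebra K L\<^esub> g = c \<odot>\<^bsub>word_algebra K L\<^esub> (f \<otimes>\<^bsub>word_algebra K L\<^esub> g)"
    if "c \<in> carrier K" "f \<in> carrier (word_algebra K L)" for c f
    using app[OF that(2)] that(1)
    by (simp add: word_algebra_sel(4,5) free_module_sel K.m_assoc K.finsum_rdistr Pi_def)
qed

lemma word_mult_linear_right:
  assumes "f \<in> carrier (word_algebra K L)"
  shows "(\<lambda>g. f \<otimes>\<^bsub>word_algebra K L\<^esub> g) \<in> linear_maps K (word_algebra K L) (word_algebra K L)"
proof (rule linear_mapsI)
  note app = free_module_app[OF K, of _ L, folded word_algebra_sel(1)]
  note [simp] = app[OF assms]
  show "f \<otimes>\<^bsub>word_algebra K L\<^esub> g \<in> carrier (word_algebra K L)" if "g \<in> carrier (word_algebra K L)" for g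
    using assms that by (rule word_mult_closed)
  show "f \<otimes>\<^bsub>word_algebra K L\<^esub> (g \<oplus>\<^bsub>word_algebra K L\<^esub> g') =
      f \<otimes>\<^bsub>word_algebra K L\<^esub> g \<oplus>\<^bsub>word_algebra K L\<^esub> f \<otimes>\<^bsub>word_algebra K L\<^esub> g'"
    if "g \<in> carrier (word_algebra K L)" "g' \<in> carrier (word_algebra K L)" for g g'
    using app[OF that(1)] app[OF that(2)]
    by (simp add: word_algebra_sel(3,5) free_module_sel K.r_distr Pi_def)
  show "f \<otimes>\<^bsub>word_algebra K L\<^esub> (c \<odot>\<^bsub>word_algebra K L\<^esub> g) = c \<odot>\<^bsub>word_algebra K L\<^esub> (f \<otimes>\<^bsub>word_algebra K L\<^esub> g)"
    if "c \<in> carrier K" "g \<in> carrier (word_algebra K L)" for c g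
    using app[OF that(2)] that(1)
    by (simp add: word_algebra_sel(4,5) free_module_sel K.m_lcomm K.finsum_rdistr Pi_def)
qed

lemma word_mult_delta:
  "delta_fun K p \<otimes>\<^bsub>word_algebra K L\<^esub> delta_fun K q = delta_fun K (p @ q)"
proof
  fix w
  have "(delta_fun K p \<otimes>\<^bsub>word_algebra K L\<^esub> delta_fun K q) w =
      (\<Oplus>\<^bsub>K\<^esub>i\<in>{..length w}. delta_fun K p (take i w) \<otimes>\<^bsub>K\<^esub> delta_fun K q (drop i w))"
    by (simp add: word_algebra_sel)
  \<comment> \<open>Only the cut of \<open>w\<close> after \<open>length p\<close> letters can match
    both words. If \<open>w\<close> is too short to have that cut, it differs from
    \<open>p @ q\<close> and both sides vanish.\<close>
  also have "\<dots> = (\<Oplus>\<^bsub>K\<^esub>i\<in>{..length w}. if length p = i then delta_fun K (p @ q) w else \<zero>\<^bsub>K\<^esub>)"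
  proof (rule K.finsum_cong')
    fix i assume i: "i \<in> {..length w}"
    have "take i w = p \<and> drop i w = q \<longleftrightarrow> length p = i \<and> w = p @ q"
      using i by (metis append_eq_conv_conj append_take_drop_id atMost_iff length_take min.absorb2)
    then show "delta_fun K p (take i w) \<otimes>\<^bsub>K\<^esub> delta_fun K q (drop i w) =
        (if length p = i then delta_fun K (p @ q) w else \<zero>\<^bsub>K\<^esub>)"
      by (auto simp: delta_fun_def)
  qed (auto simp: delta_fun_def)
  also have "\<dots> = delta_fun K (p @ q) w"
  proof (cases "w = p @ q")
    case True
    then show ?thesis
      by (subst K.add.finprod_singleton[where f = "\<lambda>_. delta_fun K (p @ q) w"]) (auto simp: delta_fun_def)
  next
    case False
    then show ?thesis by (simp add: delta_fun_def cong: if_cong)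
  qed
  finally show "(delta_fun K p \<otimes>\<^bsub>word_algebra K L\<^esub> delta_fun K q) w = delta_fun K (p @ q) w" .
qed

lemma nonunital_algebra_word_algebra: "nonunital_algebra K (word_algebra K L)"
proof -
  let ?A = "word_algebra K L"
  interpret A: module K ?A by (rule module_word_algebra[OF K])
  note eqI = linear_maps_eq_on_span[OF A.module_axioms span_word_algebra[OF K] _ _ A.module_axioms]
  note lin = word_mult_linear_left word_mult_linear_right linear_maps_compose[OF word_mult_linear_left word_mult_linear_right]
     linear_maps_compose[OF word_mult_linear_right word_mult_linear_left]
     linear_maps_compose[OF word_mult_linear_left word_mult_linear_left]
     linear_maps_compose[OF word_mult_linear_right word_mult_linear_right]
  note closed = word_mult_closed delta_fun_word_closed[OF K]
  \<comment> \<open>Both sides of associativity are trilinear, so it is extended from words to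
    arbitrary elements one argument at a time: \<open>c\<close>, then \<open>b\<close>, then
    \<open>a\<close>.\<close>
  have 1: "(delta_fun K p \<otimes>\<^bsub>?A\<^esub> delta_fun K q) \<otimes>\<^bsub>?A\<^esub> c = delta_fun K p \<otimes>\<^bsub>?A\<^esub> (delta_fun K q \<otimes>\<^bsub>?A\<^esub> c)"
    if "p \<in> L" "q \<in> L" "c \<in> carrier ?A" for p q c
    using that by (intro eqI[OF lin(2) lin(6), of _ _ _ c]) (auto simp: word_mult_delta closed intro: closed append_closed)
  have 2: "(delta_fun K p \<otimes>\<^bsub>?A\<^esub> b) \<otimes>\<^bsub>?A\<^esub> c = delta_fun K p \<otimes>\<^bsub>?A\<^esub> (b \<otimes>\<^bsub>?A\<^esub> c)"
    if "p \<in> L" "b \<in> carrier ?A" "c \<in> carrier ?A" for p b c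
    using that by (intro eqI[OF lin(4) lin(3), of _ _ _ _ b]) (auto simp: 1 closed intro: closed)
  have 3: "(a \<otimes>\<^bsub>?A\<^esub> b) \<otimes>\<^bsub>?A\<^esub> c = a \<otimes>\<^bsub>?A\<^esub> (b \<otimes>\<^bsub>?A\<^esub> c)"
    if "a \<in> carrier ?A" "b \<in> carrier ?A" "c \<in> carrier ?A" for a b c
    using that by (intro eqI[OF lin(5) lin(1), of _ _ _ a]) (auto simp: 2 closed intro: closed)
  show ?thesis
    using linear_maps_add[OF lin(1)] linear_maps_add[OF lin(2)] linear_maps_smult[OF lin(1)] linear_maps_smult[OF lin(2)]
    by (intro nonunital_algebra.intro A.module_axioms nonunital_algebra_axioms.intro closed 3) simp_all
qed

end

section \<open>The reduced tensor algebra\<close>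

context
  fixes K :: "('k, 'm) ring_scheme" and W :: "('k, 'w, 'n) module_scheme"
  assumes W: "module K W"
begin

interpretation W: module K W by (rule W)

private abbreviation (input) "FW \<equiv> word_algebra K (nonempty_words (carrier W))"

lemma module_FW: "module K FW"
  by (rule module_word_algebra[OF W.R.cring_axioms])

lemma nonunital_algebra_FW: "nonunital_algebra K FW"
  by (rule nonunital_algebra_word_algebra[OF W.R.cring_axioms]) auto

interpretation F: nonunital_algebra K FW by (rule nonunital_algebra_FW)

lemma delta_FW_closed: "ws \<in> nonempty_words (carrier W) \<Longrightarrow> delta_fun K ws \<in> carrier FW"
  by (rule delta_fun_word_closed[OF W.R.cring_axioms])

lemma multilinear_rels_cases [consumes 1, case_names add smult]:
  assumes "r \<in> multilinear_rels K W"
  obtains p q w w' where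
      "r = delta_fun K (p @ [w \<oplus>\<^bsub>W\<^esub> w'] @ q) \<ominus>\<^bsub>FW\<^esub> (delta_fun K (p @ [w] @ q) \<oplus>\<^bsub>FW\<^esub> delta_fun K (p @ [w'] @ q))"
      "p \<in> lists (carrier W)" "q \<in> lists (carrier W)" "w \<in> carrier W" "w' \<in> carrier W"
    | p q c w where
      "r = delta_fun K (p @ [c \<odot>\<^bsub>W\<^esub> w] @ q) \<ominus>\<^bsub>FW\<^esub> c \<odot>\<^bsub>FW\<^esub> delta_fun K (p @ [w] @ q)"
      "p \<in> lists (carrier W)" "q \<in> lists (carrier W)" "c \<in> carrier K" "w \<in> carrier W"
  using assms unfolding multilinear_rels_def Let_def by blast

lemma multilinear_null_rels:
  "p \<in> lists (carrier W) \<Longrightarrow> q \<in> lists (carrier W) \<Longrightarrow> w \<in> carrier W \<Longrightarrow> w' \<in> carrier W \<Longrightarrow>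
    delta_fun K (p @ [w \<oplus>\<^bsub>W\<^esub> w'] @ q) \<ominus>\<^bsub>FW\<^esub> (delta_fun K (p @ [w] @ q) \<oplus>\<^bsub>FW\<^esub> delta_fun K (p @ [w'] @ q))
      \<in> multilinear_null K W"
  "p \<in> lists (carrier W) \<Longrightarrow> q \<in> lists (carrier W) \<Longrightarrow> c \<in> carrier K \<Longrightarrow> w \<in> carrier W \<Longrightarrow>
    delta_fun K (p @ [c \<odot>\<^bsub>W\<^esub> w] @ q) \<ominus>\<^bsub>FW\<^esub> c \<odot>\<^bsub>FW\<^esub> delta_fun K (p @ [w] @ q) \<in> multilinear_null K W"
  unfolding multilinear_null_def multilinear_rels_def Let_def
  by (rule submodule_span_base, blast)+

lemma multilinear_rels_closed: "multilinear_rels K W \<subseteq> carrier FW"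
proof
  fix r assume "r \<in> multilinear_rels K W"
  then show "r \<in> carrier FW"
    by (cases rule: multilinear_rels_cases)
      (auto intro!: F.M.minus_closed F.M.a_closed F.smult_closed delta_FW_closed)
qed

lemma submodule_multilinear_null: "submodule (multilinear_null K W) K FW"
  unfolding multilinear_null_def by (rule submodule_submodule_span[OF module_FW multilinear_rels_closed])

text \<open>Multiplication by a word only lengthens the context of a relation: \<open>p\<close>
  becomes \<open>s @ p\<close>, or \<open>q\<close> becomes \<open>q @ s\<close>. The result is
  again a relation of the same family.\<close>

lemma multilinear_rels_mult:
  assumes "r \<in> multilinear_rels K W" "s \<in> nonempty_words (carrier W)"
  shows "delta_fun K s \<otimes>\<^bsub>FW\<^esub> r \<in> multilinear_null K W" "r \<otimes>\<^bsub>FW\<^esub> delta_fun K s \<in> multilinear_null K W"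
proof -
  note lin = F.mult_linear[OF delta_FW_closed[OF assms(2)]]
  note simps = linear_maps_minus[OF module_FW module_FW] linear_maps_add linear_maps_smult
  note simps = simps[OF lin(1)] simps[OF lin(2)]
  have delta: "delta_fun K p \<otimes>\<^bsub>FW\<^esub> delta_fun K q = delta_fun K (p @ q)" for p q
    by (rule word_mult_delta[OF W.R.cring_axioms]) auto
  have s: "s \<in> lists (carrier W)" using assms(2) by simp
  show "delta_fun K s \<otimes>\<^bsub>FW\<^esub> r \<in> multilinear_null K W"
    using assms(1)
  proof (cases rule: multilinear_rels_cases)
    case (add p q w w')
    then show ?thesis
      using multilinear_null_rels(1)[of "s @ p" q w w'] s by (simp add: simps delta_FW_closed delta)
  next
    case (smult p q c w)
    then show ?thesis
      using multilinear_null_rels(2)[of "s @ p" q c w] s by (simp add: simps delta_FW_closed delta)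
  qed
  show "r \<otimes>\<^bsub>FW\<^esub> delta_fun K s \<in> multilinear_null K W"
    using assms(1)
  proof (cases rule: multilinear_rels_cases)
    case (add p q w w')
    then show ?thesis
      using multilinear_null_rels(1)[of p "q @ s" w w'] s by (simp add: simps delta_FW_closed delta)
  next
    case (smult p q c w)
    then show ?thesis
      using multilinear_null_rels(2)[of p "q @ s" c w] s by (simp add: simps delta_FW_closed delta)
  qed
qed

text \<open>Two extensions in turn: for a fixed relation, from words to arbitrary multipliers
  \<open>a\<close>; then, for fixed \<open>a\<close>, from relations to their span. Each time, the
  elements whose product lies in the null space form a submodule.\<close>

lemma multilinear_null_ideal:
  assumes a: "a \<in> carrier FW" and n: "n \<in> multilinear_null K W"
  shows "a \<otimes>\<^bsub>FW\<^esub> n \<in> multilinear_null K W" "n \<otimes>\<^bsub>FW\<^esub> a \<in> multilinear_null K W"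
proof -
  note null = submodule_multilinear_null
  note span = spanD[OF span_word_algebra[OF W.R.cring_axioms]]
  have base: "a \<otimes>\<^bsub>FW\<^esub> r \<in> multilinear_null K W" "r \<otimes>\<^bsub>FW\<^esub> a \<in> multilinear_null K W"
    if r: "r \<in> multilinear_rels K W" for r
  proof -
    have rF: "r \<in> carrier FW" using multilinear_rels_closed r by blast
    have "carrier FW \<subseteq> {x \<in> carrier FW. x \<otimes>\<^bsub>FW\<^esub> r \<in> multilinear_null K W}"
      using multilinear_rels_mult[OF r] delta_FW_closed
      by (intro span submodule_vimage[OF module_FW module_FW F.mult_linear(1)[OF rF] null]) auto
    then show "a \<otimes>\<^bsub>FW\<^esub> r \<in> multilinear_null K W" using a by blast
    have "carrier FW \<subseteq> {x \<in> carrier FW. r \<otimes>\<^bsub>FW\<^esub> x \<in> multilinear_null K W}"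
      using multilinear_rels_mult[OF r] delta_FW_closed
      by (intro span submodule_vimage[OF module_FW module_FW F.mult_linear(2)[OF rF] null]) auto
    then show "r \<otimes>\<^bsub>FW\<^esub> a \<in> multilinear_null K W" using a by blast
  qed
  have "multilinear_null K W \<subseteq> {x \<in> carrier FW. a \<otimes>\<^bsub>FW\<^esub> x \<in> multilinear_null K W}"
    using base multilinear_rels_closed unfolding multilinear_null_def[of K W]
    by (intro submodule_span_least
        submodule_vimage[OF module_FW module_FW F.mult_linear(2)[OF a] null[unfolded multilinear_null_def]])
      auto
  then show "a \<otimes>\<^bsub>FW\<^esub> n \<in> multilinear_null K W" using n by blast
  have "multilinear_null K W \<subseteq> {x \<in> carrier FW. x \<otimes>\<^bsub>FW\<^esub> a \<in> multilinear_null K W}"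
    using base multilinear_rels_closed unfolding multilinear_null_def[of K W]
    by (intro submodule_span_least
        submodule_vimage[OF module_FW module_FW F.mult_linear(1)[OF a] null[unfolded multilinear_null_def]])
      auto
  then show "n \<otimes>\<^bsub>FW\<^esub> a \<in> multilinear_null K W" using n by blast
qed

lemma nonunital_algebra_red_tensor_algebra: "nonunital_algebra K (red_tensor_algebra K W)"
  unfolding red_tensor_algebra_def
  by (rule nonunital_algebra_quot_module[OF module_FW submodule_multilinear_null nonunital_algebra_FW
        multilinear_null_ideal])

lemmas red_coset =
  quot_module_carrier[OF module_FW submodule_multilinear_null]
  quot_module_add[OF module_FW submodule_multilinear_null]
  quot_module_smult[OF module_FW submodule_multilinear_null]
  coset_eq_iff[OF module_FW submodule_multilinear_null]

lemma tensor_word_closed: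
  "ws \<in> nonempty_words (carrier W) \<Longrightarrow> tensor_word K W ws \<in> carrier (red_tensor_algebra K W)"
  unfolding red_tensor_algebra_def tensor_word_def red_coset using delta_FW_closed by blast

lemma tensor_word_mult:
  assumes "p \<in> nonempty_words (carrier W)" "q \<in> nonempty_words (carrier W)"
  shows "tensor_word K W p \<otimes>\<^bsub>red_tensor_algebra K W\<^esub> tensor_word K W q = tensor_word K W (p @ q)"
proof -
  have "delta_fun K p \<otimes>\<^bsub>FW\<^esub> delta_fun K q = delta_fun K (p @ q)"
    by (rule word_mult_delta[OF W.R.cring_axioms]) auto
  then show ?thesis
    unfolding red_tensor_algebra_def tensor_word_def
    using quot_module_mult[OF module_FW submodule_multilinear_null nonunital_algebra_FW
        multilinear_null_ideal delta_FW_closed[OF assms(1)] delta_FW_closed[OF assms(2)]]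
    by simp
qed

lemma tensor_word_linear:
  assumes "p \<in> lists (carrier W)" "q \<in> lists (carrier W)"
  shows "(\<lambda>w. tensor_word K W (p @ [w] @ q)) \<in> linear_maps K W (red_tensor_algebra K W)"
proof (rule linear_mapsI)
  have closed: "delta_fun K (p @ [w] @ q) \<in> carrier FW" if "w \<in> carrier W" for w
    using that assms by (intro delta_FW_closed) auto
  show "tensor_word K W (p @ [w] @ q) \<in> carrier (red_tensor_algebra K W)" if "w \<in> carrier W" for w
    using that assms by (intro tensor_word_closed) auto
  show "tensor_word K W (p @ [w \<oplus>\<^bsub>W\<^esub> w'] @ q) =
      tensor_word K W (p @ [w] @ q) \<oplus>\<^bsub>red_tensor_algebra K W\<^esub> tensor_word K W (p @ [w'] @ q)"
    if "w \<in> carrier W" "w' \<in> carrier W" for w w'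
    unfolding tensor_word_def red_tensor_algebra_def
    using multilinear_null_rels(1)[OF assms that] closed that
    by (subst red_coset) (simp_all only: red_coset F.M.a_closed W.M.a_closed)
  show "tensor_word K W (p @ [c \<odot>\<^bsub>W\<^esub> w] @ q) = c \<odot>\<^bsub>red_tensor_algebra K W\<^esub> tensor_word K W (p @ [w] @ q)"
    if "c \<in> carrier K" "w \<in> carrier W" for c w
    unfolding tensor_word_def red_tensor_algebra_def
    using multilinear_null_rels(2)[OF assms that] closed that
    by (subst red_coset) (simp_all only: red_coset F.smult_closed W.smult_closed)
qed

lemma span_tensor_word:
  "submodule_span K (red_tensor_algebra K W) (tensor_word K W ` nonempty_words (carrier W)) =
    carrier (red_tensor_algebra K W)"
  using span_quot_module[OF module_FW submodule_multilinear_null span_word_algebra[OF W.R.cring_axioms]]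
  by (simp add: red_tensor_algebra_def tensor_word_def[abs_def] image_image)

text \<open>The family \<open>u\<close> prescribes values on words of all lengths at once. Its
  linearity in one letter, with the rest of the word fixed, matches the two kinds of relations, so
  the linear extension of \<open>u\<close> descends to the quotient.\<close>

lemma red_tensor_algebra_universal:
  assumes P: "module K P"
    and closed: "\<And>ws. ws \<in> nonempty_words (carrier W) \<Longrightarrow> u ws \<in> carrier P"
    and lin: "\<And>p q. p \<in> lists (carrier W) \<Longrightarrow> q \<in> lists (carrier W) \<Longrightarrow>
      (\<lambda>w. u (p @ [w] @ q)) \<in> linear_maps K W P"
  obtains f where "f \<in> linear_maps K (red_tensor_algebra K W) P"
    "\<And>ws. ws \<in> nonempty_words (carrier W) \<Longrightarrow> f (tensor_word K W ws) = u ws"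
proof -
  obtain f0 where f0: "f0 \<in> linear_maps K FW P"
    "\<And>ws. ws \<in> nonempty_words (carrier W) \<Longrightarrow> f0 (delta_fun K ws) = u ws"
    unfolding linear_maps_word_algebra
    by (rule free_module_universal[OF W.R.cring_axioms P, of "nonempty_words (carrier W)" u, OF closed]) blast+
  have "f0 r = \<zero>\<^bsub>P\<^esub>" if "r \<in> multilinear_rels K W" for r
    using that
  proof (cases rule: multilinear_rels_cases)
    case (add p q w w')
    show ?thesis
      using add(2-) linear_maps_add[OF lin[OF add(2,3)] add(4,5)] unfolding add(1)
      by (intro linear_maps_minus_eq_zero[OF module_FW P f0(1)])
        (simp_all add: delta_FW_closed linear_maps_add[OF f0(1)] f0(2))
  next
    case (smult p q c w)
    show ?thesis
      using smult(2-) linear_maps_smult[OF lin[OF smult(2,3)] smult(4,5)] unfolding smult(1)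
      by (intro linear_maps_minus_eq_zero[OF module_FW P f0(1)])
        (simp_all add: delta_FW_closed linear_maps_smult[OF f0(1)] f0(2))
  qed
  then have null: "f0 n = \<zero>\<^bsub>P\<^esub>" if "n \<in> multilinear_null K W" for n
    using linear_maps_vanish_on_span[OF module_FW P f0(1)] multilinear_rels_closed that
    unfolding multilinear_null_def by blast
  obtain f where f: "f \<in> linear_maps K (red_tensor_algebra K W) P"
    "\<And>a. a \<in> carrier FW \<Longrightarrow> f (multilinear_null K W +>\<^bsub>FW\<^esub> a) = f0 a"
    unfolding red_tensor_algebra_def
    by (rule quot_module_universal[OF module_FW submodule_multilinear_null f0(1) P null]) blast+
  show thesis
    by (rule that[OF f(1)]) (simp add: tensor_word_def delta_FW_closed f(2) f0(2))
qed

end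

section \<open>Products along words, generation by degree one, and maps out of the tensor
  algebra\<close>

lemma list_update_in_lists: "ws \<in> lists A \<Longrightarrow> x \<in> A \<Longrightarrow> ws[i := x] \<in> lists A"
  using set_update_subset_insert[of ws i x] by (auto simp: in_lists_conv_set)

text \<open>The target algebra need not have a unit, so the recursion ends at a single letter. The
  value on the empty word is a default that merely lies in the carrier.\<close>

fun word_prod :: "('k, 'b, 'p) module_scheme \<Rightarrow> ('w \<Rightarrow> 'b) \<Rightarrow> 'w list \<Rightarrow> 'b" where
  "word_prod B f [] = \<zero>\<^bsub>B\<^esub>"
| "word_prod B f [w] = f w"
| "word_prod B f (w # v # ws) = f w \<otimes>\<^bsub>B\<^esub> word_prod B f (v # ws)"

context nonunital_algebra
begin

lemma word_prod_closed:
  assumes "\<And>w. w \<in> S \<Longrightarrow> f w \<in> carrier A" "ws \<in> lists S"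
  shows "word_prod A f ws \<in> carrier A"
  using assms(2) by (induction ws rule: induct_list012) (auto simp: assms(1) intro!: mult_closed)

text \<open>Both words are nonempty because the default value on \<open>[]\<close> is not neutral
  for the product.\<close>

lemma word_prod_append:
  assumes f: "\<And>w. w \<in> S \<Longrightarrow> f w \<in> carrier A"
    and "p \<in> nonempty_words S" "q \<in> nonempty_words S"
  shows "word_prod A f (p @ q) = word_prod A f p \<otimes>\<^bsub>A\<^esub> word_prod A f q"
  using assms(2)
proof (induction p rule: induct_list012)
  case (2 w)
  then show ?case using assms(3) by (cases q) auto
next
  case (3 w v ws)
  then show ?case
    using assms(3) f by (auto simp: mult_assoc word_prod_closed[of S] Pi_def)
qed simp

text \<open>The product splits around the letter \<open>w\<close>, which enters through
  \<open>f\<close> followed by a right and a left multiplication. Empty \<open>q\<close> and empty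
  \<open>p\<close> are treated separately, since there is then no factor on that side.\<close>

lemma word_prod_linear:
  assumes W: "module K W" and f: "f \<in> linear_maps K W A" and p: "p \<in> lists (carrier W)" and q: "q \<in> lists (carrier W)"
  shows "(\<lambda>w. word_prod A f (p @ [w] @ q)) \<in> linear_maps K W A"
proof -
  note fc = linear_maps_closed[OF f]
  note append = word_prod_append[of "carrier W" f, OF fc]
  have right: "(\<lambda>w. word_prod A f ([w] @ q)) \<in> linear_maps K W A"
  proof (cases "q = []")
    case False
    then obtain v q' where "q = v # q'" by (cases q) auto
    then show ?thesis
      using linear_maps_compose[OF f mult_linear(1)[OF word_prod_closed[OF fc q]]] by simp
  qed (simp add: f)
  show ?thesis
  proof (cases "p = []")
    case False
    have "(\<lambda>w. word_prod A f p \<otimes>\<^bsub>A\<^esub> word_prod A f ([w] @ q)) \<in> linear_maps K W A"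
      by (rule linear_maps_compose[OF right mult_linear(2)[OF word_prod_closed[OF fc p]]])
    moreover have "word_prod A f p \<otimes>\<^bsub>A\<^esub> word_prod A f ([w] @ q) = word_prod A f (p @ [w] @ q)"
      if "w \<in> carrier W" for w
      using that p q False by (intro append[symmetric]) auto
    ultimately show ?thesis by (rule linear_maps_cong[OF W])
  qed (use right in simp)
qed

end

context
  fixes K :: "('k, 'm) ring_scheme" and W :: "('k, 'w, 'n) module_scheme"
  assumes W: "module K W"
begin

interpretation W: module K W by (rule W)

private abbreviation (input) "T \<equiv> red_tensor_algebra K W"

interpretation T: nonunital_algebra K T by (rule nonunital_algebra_red_tensor_algebra[OF W])

lemma span_tensor_word_generators:
  assumes "submodule_span K W G = carrier W"
  shows "submodule_span K T (tensor_word K W ` nonempty_words G) = carrier T"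
proof (rule spanI[OF T.module_axioms])
  have G: "G \<subseteq> carrier W" using submodule_span_base[of _ G K W] unfolding assms by blast
  show "tensor_word K W ` nonempty_words G \<subseteq> carrier T"
    using G by (auto intro!: tensor_word_closed[OF W])
  fix H assume H: "submodule H K T" "tensor_word K W ` nonempty_words G \<subseteq> H"
  \<comment> \<open>The prefix \<open>p\<close> over \<open>G\<close> grows at the expense of
    \<open>ws\<close>, one letter at a time: with the other letters fixed, the tensor is linear in
    the letter between them, so it suffices to let that letter range over \<open>G\<close>. The
    instance \<open>p = []\<close> covers all words.\<close>
  have "tensor_word K W (p @ ws) \<in> H"
    if "p \<in> lists G" "ws \<in> lists (carrier W)" "p @ ws \<noteq> []" for p ws
    using that
  proof (induction ws arbitrary: p)
    case Nil
    then have "p \<in> nonempty_words G" by simp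
    then show ?case using H(2) by auto
  next
    case (Cons w ws)
    have p: "p \<in> lists (carrier W)" using Cons.prems(1) G by auto
    have ws: "ws \<in> lists (carrier W)" using Cons.prems by simp
    have "carrier W \<subseteq> {w \<in> carrier W. tensor_word K W (p @ [w] @ ws) \<in> H}"
    proof (rule spanD[OF assms submodule_vimage[OF W T.module_axioms tensor_word_linear[OF W p ws] H(1)]], rule subsetI)
      fix g assume g: "g \<in> G"
      have "tensor_word K W ((p @ [g]) @ ws) \<in> H"
        using Cons.prems(1) g ws by (intro Cons.IH) auto
      then show "g \<in> {w \<in> carrier W. tensor_word K W (p @ [w] @ ws) \<in> H}" using g G by auto
    qed
    then show ?case using Cons.prems(2) by auto
  qed
  from this[of "[]"] have "tensor_word K W ` nonempty_words (carrier W) \<subseteq> H" by auto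
  then show "carrier T \<subseteq> H" by (rule spanD[OF span_tensor_word[OF W] H(1)])
qed

text \<open>Words over \<open>G\<close> span the tensor algebra, and each of them is the product of
  its letters.\<close>

lemma red_tensor_algebra_generated:
  assumes "submodule_span K W G = carrier W" "submodule H K T"
    and mult: "\<And>a b. a \<in> H \<Longrightarrow> b \<in> H \<Longrightarrow> a \<otimes>\<^bsub>T\<^esub> b \<in> H"
    and gen: "\<And>g. g \<in> G \<Longrightarrow> tensor_word K W [g] \<in> H"
  shows "carrier T \<subseteq> H"
proof (rule spanD[OF span_tensor_word_generators[OF assms(1)] assms(2)], rule subsetI)
  have G: "G \<subseteq> carrier W" using submodule_span_base[of _ G K W] unfolding assms(1) by blast
  fix x assume "x \<in> tensor_word K W ` nonempty_words G"
  then obtain ws where x: "x = tensor_word K W ws" and "ws \<in> lists G" "ws \<noteq> []" by auto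
  from this(2,3) show "x \<in> H"
    unfolding x
  proof (induction ws rule: induct_list012)
    case (3 g g' ws)
    then have "tensor_word K W [g] \<otimes>\<^bsub>T\<^esub> tensor_word K W (g' # ws) \<in> H"
      by (intro mult gen) auto
    moreover have "tensor_word K W [g] \<otimes>\<^bsub>T\<^esub> tensor_word K W (g' # ws) = tensor_word K W ([g] @ g' # ws)"
      using 3 G by (intro tensor_word_mult[OF W]) auto
    ultimately show ?case by simp
  qed (auto intro: gen)
qed

text \<open>A word goes to the product of the images of its letters, which is multilinear. On words,
  multiplicativity is \<open>word_prod_append\<close>; it is then extended linearly in the second
  factor and after that in the first.\<close>

lemma red_tensor_algebra_hom_exists:
  assumes B: "nonunital_algebra K B" and f: "f \<in> linear_maps K W B"
  obtains g where "g \<in> linear_maps K T B" "\<And>w. w \<in> carrier W \<Longrightarrow> g (tensor_word K W [w]) = f w"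
    "\<And>a b. a \<in> carrier T \<Longrightarrow> b \<in> carrier T \<Longrightarrow> g (a \<otimes>\<^bsub>T\<^esub> b) = g a \<otimes>\<^bsub>B\<^esub> g b"
proof -
  interpret B: nonunital_algebra K B by (rule B)
  note fc = linear_maps_closed[OF f]
  obtain g where g: "g \<in> linear_maps K T B"
    "\<And>ws. ws \<in> nonempty_words (carrier W) \<Longrightarrow> g (tensor_word K W ws) = word_prod B f ws"
    using red_tensor_algebra_universal[OF W B.module_axioms, of "word_prod B f"]
      B.word_prod_closed[of "carrier W" f, OF fc] B.word_prod_linear[OF W f] by (metis DiffD1)
  note span = span_tensor_word[OF W]
  note gc = linear_maps_closed[OF g(1)]
  have 1: "g (tensor_word K W p \<otimes>\<^bsub>T\<^esub> tensor_word K W q) = g (tensor_word K W p) \<otimes>\<^bsub>B\<^esub> g (tensor_word K W q)"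
    if "p \<in> nonempty_words (carrier W)" "q \<in> nonempty_words (carrier W)" for p q
  proof -
    have "p @ q \<in> nonempty_words (carrier W)" using that by auto
    then show ?thesis
      using that B.word_prod_append[of "carrier W" f p q, OF fc] by (simp only: tensor_word_mult[OF W] g(2))
  qed
  have 2: "g (tensor_word K W p \<otimes>\<^bsub>T\<^esub> b) = g (tensor_word K W p) \<otimes>\<^bsub>B\<^esub> g b"
    if p: "p \<in> nonempty_words (carrier W)" and "b \<in> carrier T" for p b
  proof (rule linear_maps_eq_on_span[OF T.module_axioms span _ _ B.module_axioms _ \<open>b \<in> carrier T\<close>])
    note tp = tensor_word_closed[OF W p]
    show "(\<lambda>b. g (tensor_word K W p \<otimes>\<^bsub>T\<^esub> b)) \<in> linear_maps K T B"
      by (rule linear_maps_compose[OF T.mult_linear(2)[OF tp] g(1)])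
    show "(\<lambda>b. g (tensor_word K W p) \<otimes>\<^bsub>B\<^esub> g b) \<in> linear_maps K T B"
      by (rule linear_maps_compose[OF g(1) B.mult_linear(2)[OF gc[OF tp]]])
  qed (use 1[OF p] in blast)
  have 3: "g (a \<otimes>\<^bsub>T\<^esub> b) = g a \<otimes>\<^bsub>B\<^esub> g b" if "a \<in> carrier T" and b: "b \<in> carrier T" for a b
  proof (rule linear_maps_eq_on_span[OF T.module_axioms span _ _ B.module_axioms _ \<open>a \<in> carrier T\<close>])
    show "(\<lambda>a. g (a \<otimes>\<^bsub>T\<^esub> b)) \<in> linear_maps K T B"
      by (rule linear_maps_compose[OF T.mult_linear(1)[OF b] g(1)])
    show "(\<lambda>a. g a \<otimes>\<^bsub>B\<^esub> g b) \<in> linear_maps K T B"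
      by (rule linear_maps_compose[OF g(1) B.mult_linear(1)[OF gc[OF b]]])
  qed (use 2[OF _ b] in blast)
  show thesis
    by (rule that[OF g(1) _ 3]) (simp_all add: g(2))
qed

lemma tensor_word_shift_exists:
  assumes D: "\<And>i. D i \<in> linear_maps K W W"
  obtains f where "f \<in> linear_maps K T T"
    "\<And>ws. ws \<in> nonempty_words (carrier W) \<Longrightarrow>
      f (tensor_word K W ws) = (\<Oplus>\<^bsub>T\<^esub>i\<in>{..<length ws}. tensor_word K W (ws[i := D i (ws ! i)]))"
proof -
  define u where "u ws = (\<Oplus>\<^bsub>T\<^esub>i\<in>{..<length ws}. tensor_word K W (ws[i := D i (ws ! i)]))" for ws
  note Dc = linear_maps_closed[OF D]
  have upd: "ws[i := D i (ws ! i)] \<in> lists (carrier W)" if "ws \<in> lists (carrier W)" "i < length ws" for ws i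
    using that nth_mem[of i ws] by (intro list_update_in_lists Dc) auto
  have "u ws \<in> carrier T" if "ws \<in> nonempty_words (carrier W)" for ws
    unfolding u_def using that upd by (intro T.M.finsum_closed) (auto intro!: tensor_word_closed[OF W])
  moreover have "(\<lambda>w. u (p @ [w] @ q)) \<in> linear_maps K W T"
    if p: "p \<in> lists (carrier W)" and q: "q \<in> lists (carrier W)" for p q
  proof -
    \<comment> \<open>Each summand is linear in the letter \<open>w\<close> at position
      \<open>length p\<close>: for any other \<open>i\<close> only the context of \<open>w\<close>
      is altered, and for \<open>i = length p\<close> the letter passes through the linear map
      \<open>D i\<close> first.\<close>
    have "(\<lambda>w. tensor_word K W ((p @ [w] @ q)[i := D i ((p @ [w] @ q) ! i)])) \<in> linear_maps K W T"
      if i: "i < length p + Suc (length q)" for i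
    proof -
      consider "i < length p" | "i = length p" | j where "i = length p + Suc j" "j < length q"
      proof (cases i "length p" rule: linorder_cases)
        case greater
        then obtain j where "i = Suc (length p + j)" by (blast dest: less_imp_Suc_add)
        then show thesis using i that(3)[of j] by simp
      qed (use that in auto)
      then show ?thesis
      proof cases
        case 1
        then show ?thesis
          using tensor_word_linear[OF W upd[OF p 1] q] by (simp add: list_update_append nth_append)
      next
        case 2
        then show ?thesis
          using linear_maps_compose[OF D tensor_word_linear[OF W p q]] by (simp add: nth_append)
      next
        case 3
        have "q[j := D i (q ! j)] \<in> lists (carrier W)"
          using q 3(2) nth_mem[of j q] by (intro list_update_in_lists Dc) auto
        then show ?thesis
          using tensor_word_linear[OF W p] 3 by (simp add: list_update_append nth_append)
      qed
    qed
    then have "(\<lambda>w. \<Oplus>\<^bsub>T\<^esub>i\<in>{..<length p + Suc (length q)}.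
        tensor_word K W ((p @ [w] @ q)[i := D i ((p @ [w] @ q) ! i)])) \<in> linear_maps K W T"
      by (intro linear_maps_finsum_fun W T.module_axioms) auto
    then show ?thesis unfolding u_def by simp
  qed
  ultimately show thesis
    using red_tensor_algebra_universal[OF W T.module_axioms, of u] that unfolding u_def by blast
qed

text \<open>A constant \<open>D\<close> gives the Leibniz rule for \<open>f = h\<close>; a different map in position \<open>0\<close> gives the rule for \<open>\<delta>\<close>.\<close>

lemma tensor_word_leibniz:
  assumes G: "submodule_span K W G = carrier W"
    and lin: "f \<in> linear_maps K T T" "h \<in> linear_maps K T T"
    and D: "\<And>i w. w \<in> G \<Longrightarrow> D i w \<in> carrier W"
    and f: "\<And>ws. ws \<in> nonempty_words G \<Longrightarrow>
      f (tensor_word K W ws) = (\<Oplus>\<^bsub>T\<^esub>i\<in>{..<length ws}. tensor_word K W (ws[i := D i (ws ! i)]))"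
    and h: "\<And>ws. ws \<in> nonempty_words G \<Longrightarrow>
      h (tensor_word K W ws) = (\<Oplus>\<^bsub>T\<^esub>i\<in>{..<length ws}. tensor_word K W (ws[i := X (ws ! i)]))"
    and DX: "\<And>i. D (Suc i) = X"
    and ab: "a \<in> carrier T" "b \<in> carrier T"
  shows "f (a \<otimes>\<^bsub>T\<^esub> b) = f a \<otimes>\<^bsub>T\<^esub> b \<oplus>\<^bsub>T\<^esub> a \<otimes>\<^bsub>T\<^esub> h b"
proof -
  have GW: "G \<subseteq> carrier W" using submodule_span_base[of _ G K W] unfolding G by blast
  then have words: "nonempty_words G \<subseteq> nonempty_words (carrier W)" by auto
  \<comment> \<open>The index \<open>j\<close> of the map is independent of the position
    \<open>i\<close>, so that \<open>j = Suc 0\<close> covers the updates by \<open>X\<close> as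
    well.\<close>
  have upd: "ws[i := D j (ws ! i)] \<in> nonempty_words (carrier W)" if "ws \<in> nonempty_words G" "i < length ws" for ws i j
  proof -
    have "ws[i := D j (ws ! i)] \<in> lists (carrier W)"
      using that words nth_mem[of i ws] by (intro list_update_in_lists D) auto
    then show ?thesis using that by auto
  qed
  have 1: "f (tensor_word K W p \<otimes>\<^bsub>T\<^esub> tensor_word K W q) =
      f (tensor_word K W p) \<otimes>\<^bsub>T\<^esub> tensor_word K W q \<oplus>\<^bsub>T\<^esub> tensor_word K W p \<otimes>\<^bsub>T\<^esub> h (tensor_word K W q)"
    if p: "p \<in> nonempty_words G" and q: "q \<in> nonempty_words G" for p q
  proof -
    note p' = subsetD[OF words p] and q' = subsetD[OF words q]
    have pq: "p @ q \<in> nonempty_words G" using p q by auto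
    define t where "t i = tensor_word K W ((p @ q)[i := D i ((p @ q) ! i)])" for i
    have tc: "t i \<in> carrier T" if "i < length p + length q" for i
      unfolding t_def using upd[OF pq] that by (intro tensor_word_closed[OF W]) auto
    have t1: "t i = tensor_word K W (p[i := D i (p ! i)]) \<otimes>\<^bsub>T\<^esub> tensor_word K W q" if "i < length p" for i
      using that upd[OF p that] q' by (simp add: t_def tensor_word_mult[OF W] list_update_append nth_append)
    have t2: "t (length p + j) = tensor_word K W p \<otimes>\<^bsub>T\<^esub> tensor_word K W (q[j := X (q ! j)])" if "j < length q" for j
    proof -
      \<comment> \<open>Since \<open>p\<close> is nonempty, a letter of \<open>q\<close> stands at a
        positive position of \<open>p @ q\<close>, where the map is \<open>X\<close>. Hence
        \<open>h\<close>, and not \<open>f\<close>, appears on the second factor.\<close>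
      have "D (length p + j) = X" using p DX[of "length p + j - 1"] by (cases p) auto
      then show ?thesis
        using that upd[OF q that, of "Suc 0", unfolded DX] p'
        by (simp add: t_def tensor_word_mult[OF W] list_update_append nth_append)
    qed
    have "f (tensor_word K W p \<otimes>\<^bsub>T\<^esub> tensor_word K W q) = (\<Oplus>\<^bsub>T\<^esub>i\<in>{..<length p + length q}. t i)"
      using f[OF pq] by (simp add: tensor_word_mult[OF W p' q'] t_def)
    also have "{..<length p + length q} = {..<length p} \<union> (\<lambda>j. length p + j) ` {..<length q}"
      by (auto simp: image_iff) (metis le_add_diff_inverse lessThan_iff linorder_not_less nat_add_left_cancel_less)
    also have "(\<Oplus>\<^bsub>T\<^esub>i\<in>\<dots>. t i) = (\<Oplus>\<^bsub>T\<^esub>i\<in>{..<length p}. t i) \<oplus>\<^bsub>T\<^esub> (\<Oplus>\<^bsub>T\<^esub>i\<in>(\<lambda>j. length p + j) ` {..<length q}. t i)"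
      using tc by (intro T.M.finsum_Un_disjoint) auto
    also have "(\<Oplus>\<^bsub>T\<^esub>i\<in>(\<lambda>j. length p + j) ` {..<length q}. t i) = (\<Oplus>\<^bsub>T\<^esub>j\<in>{..<length q}. t (length p + j))"
      using tc by (intro T.M.finsum_reindex) auto
    also have "\<dots> = (\<Oplus>\<^bsub>T\<^esub>j\<in>{..<length q}. tensor_word K W p \<otimes>\<^bsub>T\<^esub> tensor_word K W (q[j := X (q ! j)]))"
      using t2 tc by (intro T.M.finsum_cong') (auto simp flip: t2)
    also have "\<dots> = tensor_word K W p \<otimes>\<^bsub>T\<^esub> h (tensor_word K W q)"
      unfolding h[OF q] using upd[OF q, of _ "Suc 0", unfolded DX]
      by (intro linear_maps_finsum[symmetric, OF T.module_axioms T.module_axioms T.mult_linear(2)] tensor_word_closed[OF W] p') auto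
    also have "(\<Oplus>\<^bsub>T\<^esub>i\<in>{..<length p}. t i) =
        (\<Oplus>\<^bsub>T\<^esub>i\<in>{..<length p}. tensor_word K W (p[i := D i (p ! i)]) \<otimes>\<^bsub>T\<^esub> tensor_word K W q)"
      using t1 tc by (intro T.M.finsum_cong') (auto simp flip: t1)
    also have "\<dots> = f (tensor_word K W p) \<otimes>\<^bsub>T\<^esub> tensor_word K W q"
      unfolding f[OF p] using upd[OF p]
      by (intro linear_maps_finsum[symmetric, OF T.module_axioms T.module_axioms T.mult_linear(1)] tensor_word_closed[OF W] q') auto
    finally show ?thesis .
  qed
  note span = span_tensor_word_generators[OF G]
  \<comment> \<open>Both sides are linear in \<open>b\<close>, and below in \<open>a\<close>, so the
    identity passes from words over \<open>G\<close> to all elements.\<close>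
  have 2: "f (tensor_word K W p \<otimes>\<^bsub>T\<^esub> b) = f (tensor_word K W p) \<otimes>\<^bsub>T\<^esub> b \<oplus>\<^bsub>T\<^esub> tensor_word K W p \<otimes>\<^bsub>T\<^esub> h b"
    if p: "p \<in> nonempty_words G" for p
  proof (rule linear_maps_eq_on_span[OF T.module_axioms span _ _ T.module_axioms _ ab(2)])
    note tp = tensor_word_closed[OF W subsetD[OF words p]]
    show "(\<lambda>b. f (tensor_word K W p \<otimes>\<^bsub>T\<^esub> b)) \<in> linear_maps K T T"
      by (rule linear_maps_compose[OF T.mult_linear(2)[OF tp] lin(1)])
    show "(\<lambda>b. f (tensor_word K W p) \<otimes>\<^bsub>T\<^esub> b \<oplus>\<^bsub>T\<^esub> tensor_word K W p \<otimes>\<^bsub>T\<^esub> h b) \<in> linear_maps K T T"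
      by (intro linear_maps_plus T.module_axioms linear_maps_compose[OF lin(2) T.mult_linear(2)[OF tp]]
          T.mult_linear(2) linear_maps_closed[OF lin(1)] tp)
  qed (use 1[OF p] in blast)
  show ?thesis
  proof (rule linear_maps_eq_on_span[OF T.module_axioms span _ _ T.module_axioms _ ab(1)])
    show "(\<lambda>a. f (a \<otimes>\<^bsub>T\<^esub> b)) \<in> linear_maps K T T"
      by (rule linear_maps_compose[OF T.mult_linear(1)[OF ab(2)] lin(1)])
    show "(\<lambda>a. f a \<otimes>\<^bsub>T\<^esub> b \<oplus>\<^bsub>T\<^esub> a \<otimes>\<^bsub>T\<^esub> h b) \<in> linear_maps K T T"
      by (intro linear_maps_plus T.module_axioms linear_maps_compose[OF lin(1) T.mult_linear(1)[OF ab(2)]]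
          T.mult_linear(1) linear_maps_closed[OF lin(2)] ab(2))
  qed (use 2 in blast)
qed

end

section \<open>The free AsGDer triple\<close>

text \<open>With \<open>foldr\<close> the first letter acts last, in accordance with left
  multiplication: \<open>xw\<close> acts as \<open>h\<close> after \<open>w\<close>.\<close>

definition letter_action :: "('b \<Rightarrow> 'b) \<Rightarrow> ('b \<Rightarrow> 'b) \<Rightarrow> letter list \<Rightarrow> 'b \<Rightarrow> 'b" where
  "letter_action h \<delta> = foldr (\<lambda>a. case a of LX \<Rightarrow> h | LY \<Rightarrow> \<delta>)"

lemma letter_action_simps:
  "letter_action h \<delta> [] b = b"
  "letter_action h \<delta> (LX # w) b = h (letter_action h \<delta> w b)"
  "letter_action h \<delta> (LY # w) b = \<delta> (letter_action h \<delta> w b)"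
  by (simp_all add: letter_action_def)

lemma letter_action_linear:
  assumes "h \<in> linear_maps K B B" "\<delta> \<in> linear_maps K B B"
  shows "letter_action h \<delta> w \<in> linear_maps K B B"
proof (induction w)
  case Nil
  have "letter_action h \<delta> [] = (\<lambda>b. b)" by (simp add: letter_action_simps fun_eq_iff)
  then show ?case by (simp add: linear_maps_ident)
next
  case (Cons a w)
  have "letter_action h \<delta> (a # w) = (\<lambda>b. (case a of LX \<Rightarrow> h | LY \<Rightarrow> \<delta>) (letter_action h \<delta> w b))"
    by (simp add: letter_action_def fun_eq_iff)
  then show ?case
    using linear_maps_compose[OF Cons.IH] assms by (cases a) simp_all
qed

section \<open>The letter maps on \<open>W\<close> and the two predicates as sums over
  positions\<close>

context
  fixes K :: "('k, 'm) ring_scheme" and V :: "('k, 'v, 'n) module_scheme"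
  assumes V: "module K V"
begin

interpretation V: module K V by (rule V)

private abbreviation (input) "A \<equiv> free_algebra_xy K"
private abbreviation (input) "W \<equiv> W_space K V"
private abbreviation (input) "gv \<equiv> pure_tensor K (free_algebra_xy K) V"

interpretation A: nonunital_algebra K A
  unfolding free_algebra_xy_def by (rule nonunital_algebra_word_algebra[OF V.R.cring_axioms]) simp

lemma delta_xy_closed: "delta_fun K w \<in> carrier A"
  unfolding free_algebra_xy_def by (rule delta_fun_word_closed[OF V.R.cring_axioms]) simp

lemma span_xy: "submodule_span K A (range (delta_fun K)) = carrier A"
  unfolding free_algebra_xy_def by (rule span_word_algebra[OF V.R.cring_axioms])

lemma var_xy_mult: "var_xy K a \<otimes>\<^bsub>A\<^esub> delta_fun K w = delta_fun K (a # w)"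
  unfolding free_algebra_xy_def using word_mult_delta[OF V.R.cring_axioms, of UNIV "[a]" w] by simp

lemma one_xy: "\<one>\<^bsub>A\<^esub> = delta_fun K []"
  by (simp add: free_algebra_xy_def word_algebra_def)

lemma module_W_space: "module K W"
  unfolding W_space_def by (rule module_tensor_product[OF A.module_axioms V])

lemma gv_linear:
  "v \<in> carrier V \<Longrightarrow> (\<lambda>g. gv g v) \<in> linear_maps K A W"
  "g \<in> carrier A \<Longrightarrow> (\<lambda>v. gv g v) \<in> linear_maps K V W"
  unfolding W_space_def by (auto intro: pure_tensor_linear_left pure_tensor_linear_right A.module_axioms V)

lemma gv_closed: "g \<in> carrier A \<Longrightarrow> v \<in> carrier V \<Longrightarrow> gv g v \<in> carrier W"
  using linear_maps_closed[OF gv_linear(1)] .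

lemma span_gv: "submodule_span K W {gv g v |g v. g \<in> carrier A \<and> v \<in> carrier V} = carrier W"
  unfolding W_space_def by (rule span_pure_tensor[OF A.module_axioms V])

text \<open>Linearity of \<open>gv g v\<close> in \<open>g\<close> reduces polynomials to words, on
  which \<open>letter_action\<close> is defined.\<close>

lemma span_gv_words: "submodule_span K W {gv (delta_fun K w) v |w v. v \<in> carrier V} = carrier W"
proof (rule spanI[OF module_W_space])
  show "{gv (delta_fun K w) v |w v. v \<in> carrier V} \<subseteq> carrier W"
    by (auto intro: gv_closed delta_xy_closed)
  fix H assume H: "submodule H K W" "{gv (delta_fun K w) v |w v. v \<in> carrier V} \<subseteq> H"
  have "carrier A \<subseteq> {g \<in> carrier A. gv g v \<in> H}" if v: "v \<in> carrier V" for v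
    using H(2) v delta_xy_closed
    by (intro spanD[OF span_xy]
        submodule_vimage[OF A.module_axioms module_W_space gv_linear(1)[OF v] H(1)]) auto
  then show "carrier W \<subseteq> H" by (intro spanD[OF span_gv H(1)]) auto
qed

text \<open>\<open>gv_tensor_mult_at\<close> alters a pair \<open>(g, v)\<close>, which its pure
  tensor does not determine. The change is nevertheless induced by a linear map of \<open>W\<close>,
  left multiplication by a variable tensored with the identity. Having one family for both letters
  allows the letter to vary with the position.\<close>

lemma W_space_letter_maps:
  obtains X where "\<And>a. X a \<in> linear_maps K W W"
    "\<And>a. \<forall>g\<in>carrier A. \<forall>v\<in>carrier V. X a (gv g v) = gv (var_xy K a \<otimes>\<^bsub>A\<^esub> g) v"
proof -
  have "\<exists>f. f \<in> linear_maps K W W \<and>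
      (\<forall>g\<in>carrier A. \<forall>v\<in>carrier V. f (gv g v) = gv (var_xy K a \<otimes>\<^bsub>A\<^esub> g) v)" for a
  proof -
    have "(\<lambda>g. gv (var_xy K a \<otimes>\<^bsub>A\<^esub> g) v) \<in> linear_maps K A W" if "v \<in> carrier V" for v
      by (rule linear_maps_compose[OF A.mult_linear(2)[OF delta_xy_closed] gv_linear(1)[OF that]])
    moreover have "(\<lambda>v. gv (var_xy K a \<otimes>\<^bsub>A\<^esub> g) v) \<in> linear_maps K V W" if "g \<in> carrier A" for g
      by (rule gv_linear(2)[OF A.mult_closed[OF delta_xy_closed that]])
    ultimately show ?thesis
      by (rule tensor_product_universal[OF A.module_axioms V module_W_space, folded W_space_def]) blast+
  qed
  then obtain X where "\<forall>a. X a \<in> linear_maps K W W \<and>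
      (\<forall>g\<in>carrier A. \<forall>v\<in>carrier V. X a (gv g v) = gv (var_xy K a \<otimes>\<^bsub>A\<^esub> g) v)"
    by metis
  then show thesis using that by blast
qed

lemma gv_tensor_mult_at_eq:
  assumes X: "\<forall>g\<in>carrier A. \<forall>v\<in>carrier V. X (gv g v) = gv (var_xy K a \<otimes>\<^bsub>A\<^esub> g) v"
    and "gvs \<in> lists (carrier A \<times> carrier V)" "i < length gvs"
  shows "gv_tensor_mult_at K V a i gvs =
    tensor_word K W ((map (\<lambda>(g, v). gv g v) gvs)[i := X (map (\<lambda>(g, v). gv g v) gvs ! i)])"
proof -
  have "gvs ! i \<in> carrier A \<times> carrier V" using assms(2,3) nth_mem[of i gvs] by blast
  then show ?thesis
    using assms(3) X by (auto simp: gv_tensor_mult_at_def gv_tensor_def map_update)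
qed

text \<open>Trades the lists of pairs in \<open>is_h\<close> and \<open>is_\<delta>\<close> for
  words over a spanning set of \<open>W\<close>, the form that \<open>tensor_word_leibniz\<close>
  expects.\<close>

lemma nonempty_words_gv:
  "nonempty_words {gv g v |g v. g \<in> carrier A \<and> v \<in> carrier V} =
    map (\<lambda>(g, v). gv g v) ` nonempty_words (carrier A \<times> carrier V)"
proof -
  have "{gv g v |g v. g \<in> carrier A \<and> v \<in> carrier V} = (\<lambda>(g, v). gv g v) ` (carrier A \<times> carrier V)"
    by auto
  then show ?thesis by (auto simp: lists_image)
qed

interpretation T: nonunital_algebra K "TW K V"
  unfolding TW_def by (rule nonunital_algebra_red_tensor_algebra[OF module_W_space])

lemma gv_tensor_mult_at_closed:
  assumes "gvs \<in> lists (carrier A \<times> carrier V)" "i < length gvs"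
  shows "gv_tensor_mult_at K V a i gvs \<in> carrier (TW K V)"
proof -
  obtain X where X: "X \<in> linear_maps K W W"
    "\<forall>g\<in>carrier A. \<forall>v\<in>carrier V. X (gv g v) = gv (var_xy K a \<otimes>\<^bsub>A\<^esub> g) v"
    using W_space_letter_maps by metis
  have ws: "map (\<lambda>(g, v). gv g v) gvs \<in> lists (carrier W)"
    using assms(1) by (auto intro!: gv_closed)
  then have "X (map (\<lambda>(g, v). gv g v) gvs ! i) \<in> carrier W"
    using assms(2) nth_mem[of i "map (\<lambda>(g, v). gv g v) gvs"] by (intro linear_maps_closed[OF X(1)]) auto
  then show ?thesis
    unfolding gv_tensor_mult_at_eq[of X, OF X(2) assms] TW_def
    using assms(2) list_update_in_lists[OF ws] by (intro tensor_word_closed[OF module_W_space]) auto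
qed

text \<open>Both maps sum over all positions, multiplying position \<open>i\<close> by a letter that depends on \<open>i\<close> only.
  In this form they are treated uniformly.\<close>

lemma is_h_iff:
  assumes X: "\<And>a. \<forall>g\<in>carrier A. \<forall>v\<in>carrier V. X a (gv g v) = gv (var_xy K a \<otimes>\<^bsub>A\<^esub> g) v"
  shows "is_h K V h \<longleftrightarrow> h \<in> linear_maps K (TW K V) (TW K V) \<and>
    (\<forall>ws \<in> nonempty_words {gv g v |g v. g \<in> carrier A \<and> v \<in> carrier V}.
      h (tensor_word K W ws) = (\<Oplus>\<^bsub>TW K V\<^esub>i\<in>{..<length ws}. tensor_word K W (ws[i := X LX (ws ! i)])))"
proof -
  have "(\<Oplus>\<^bsub>TW K V\<^esub>i\<in>{..<length gvs}. gv_tensor_mult_at K V LX i gvs) =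
      (\<Oplus>\<^bsub>TW K V\<^esub>i\<in>{..<length gvs}. tensor_word K W ((map (\<lambda>(g, v). gv g v) gvs)[i := X LX (map (\<lambda>(g, v). gv g v) gvs ! i)]))"
    if "gvs \<in> nonempty_words (carrier A \<times> carrier V)" for gvs
    using that gv_tensor_mult_at_eq[of "X LX", OF X] gv_tensor_mult_at_closed[of gvs _ LX]
    by (intro T.M.finsum_cong') (auto simp del: in_lists_conv_set)
  then show ?thesis
    unfolding is_h_def nonempty_words_gv by (simp add: gv_tensor_def)
qed

lemma is_\<delta>_iff:
  assumes X: "\<And>a. \<forall>g\<in>carrier A. \<forall>v\<in>carrier V. X a (gv g v) = gv (var_xy K a \<otimes>\<^bsub>A\<^esub> g) v"
  shows "is_\<delta> K V \<delta> \<longleftrightarrow> \<delta> \<in> linear_maps K (TW K V) (TW K V) \<and>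
    (\<forall>ws \<in> nonempty_words {gv g v |g v. g \<in> carrier A \<and> v \<in> carrier V}.
      \<delta> (tensor_word K W ws) = (\<Oplus>\<^bsub>TW K V\<^esub>i\<in>{..<length ws}.
        tensor_word K W (ws[i := X (case i of 0 \<Rightarrow> LY | Suc j \<Rightarrow> LX) (ws ! i)])))"
proof -
  have "gv_tensor_mult_at K V LY 0 gvs \<oplus>\<^bsub>TW K V\<^esub> (\<Oplus>\<^bsub>TW K V\<^esub>i\<in>{1..<length gvs}. gv_tensor_mult_at K V LX i gvs) =
      (\<Oplus>\<^bsub>TW K V\<^esub>i\<in>{..<length gvs}. tensor_word K W
        ((map (\<lambda>(g, v). gv g v) gvs)[i := X (case i of 0 \<Rightarrow> LY | Suc j \<Rightarrow> LX) (map (\<lambda>(g, v). gv g v) gvs ! i)]))"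
    if gvs: "gvs \<in> nonempty_words (carrier A \<times> carrier V)" for gvs
  proof -
    define t where "t i = tensor_word K W
        ((map (\<lambda>(g, v). gv g v) gvs)[i := X (case i of 0 \<Rightarrow> LY | Suc j \<Rightarrow> LX) (map (\<lambda>(g, v). gv g v) gvs ! i)])" for i
    have t: "t i = gv_tensor_mult_at K V (case i of 0 \<Rightarrow> LY | Suc j \<Rightarrow> LX) i gvs" if "i < length gvs" for i
      unfolding t_def using gvs that
      by (intro gv_tensor_mult_at_eq[symmetric]) (auto simp: X simp del: in_lists_conv_set)
    have tc: "t i \<in> carrier (TW K V)" if "i < length gvs" for i
      unfolding t[OF that] using gvs that by (intro gv_tensor_mult_at_closed) auto
    have pos: "0 < length gvs" using gvs by auto
    \<comment> \<open>Position 0 exists because \<open>gvs\<close> is nonempty. It carries the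
      letter \<open>LY\<close>, all later ones carry \<open>LX\<close>.\<close>
    then have "{..<length gvs} = insert 0 {1..<length gvs}" by auto
    then have "(\<Oplus>\<^bsub>TW K V\<^esub>i\<in>{..<length gvs}. t i) = t 0 \<oplus>\<^bsub>TW K V\<^esub> (\<Oplus>\<^bsub>TW K V\<^esub>i\<in>{1..<length gvs}. t i)"
      using tc pos by simp
    also have "(\<Oplus>\<^bsub>TW K V\<^esub>i\<in>{1..<length gvs}. t i) = (\<Oplus>\<^bsub>TW K V\<^esub>i\<in>{1..<length gvs}. gv_tensor_mult_at K V LX i gvs)"
      using gvs by (intro T.M.finsum_cong')
        (auto simp: t gr0_conv_Suc Suc_le_eq simp del: in_lists_conv_set intro!: gv_tensor_mult_at_closed)
    finally show ?thesis using t[OF pos] by (simp add: t_def)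
  qed
  then show ?thesis
    unfolding is_\<delta>_def nonempty_words_gv by (simp add: gv_tensor_def)
qed

text \<open>The prescribed formulas are mutually consistent because they restrict formulas on all
  words over \<open>W\<close> that are linear in each letter.\<close>

lemma is_h_is_\<delta>_exist: "\<exists>h \<delta>. is_h K V h \<and> is_\<delta> K V \<delta>"
proof -
  obtain X where X: "\<And>a. X a \<in> linear_maps K W W"
    "\<And>a. \<forall>g\<in>carrier A. \<forall>v\<in>carrier V. X a (gv g v) = gv (var_xy K a \<otimes>\<^bsub>A\<^esub> g) v"
    using W_space_letter_maps by blast
  have words: "ws \<in> nonempty_words (carrier W)"
    if "ws \<in> nonempty_words {gv g v |g v. g \<in> carrier A \<and> v \<in> carrier V}" for ws
    using that by (auto intro: gv_closed)
  obtain h where h: "h \<in> linear_maps K (TW K V) (TW K V)"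
    "\<And>ws. ws \<in> nonempty_words (carrier W) \<Longrightarrow> h (tensor_word K W ws) =
      (\<Oplus>\<^bsub>TW K V\<^esub>i\<in>{..<length ws}. tensor_word K W (ws[i := X LX (ws ! i)]))"
    unfolding TW_def using tensor_word_shift_exists[OF module_W_space, of "\<lambda>_. X LX"] X(1) by blast
  obtain \<delta> where \<delta>: "\<delta> \<in> linear_maps K (TW K V) (TW K V)"
    "\<And>ws. ws \<in> nonempty_words (carrier W) \<Longrightarrow> \<delta> (tensor_word K W ws) =
      (\<Oplus>\<^bsub>TW K V\<^esub>i\<in>{..<length ws}. tensor_word K W (ws[i := X (case i of 0 \<Rightarrow> LY | Suc j \<Rightarrow> LX) (ws ! i)]))"
    unfolding TW_def
    using tensor_word_shift_exists[OF module_W_space, of "\<lambda>i. X (case i of 0 \<Rightarrow> LY | Suc j \<Rightarrow> LX)"] X(1) by blast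
  have "is_h K V h"
    unfolding is_h_iff[of X, OF X(2)] using h(1) h(2)[OF words] by simp
  moreover have "is_\<delta> K V \<delta>"
    unfolding is_\<delta>_iff[of X, OF X(2)] using \<delta>(1) \<delta>(2)[OF words] by simp
  ultimately show ?thesis by blast
qed

lemma asgder_TW:
  assumes "is_h K V h" "is_\<delta> K V \<delta>"
  shows "asgder K (TW K V) h \<delta>"
proof -
  obtain X where X: "\<And>a. X a \<in> linear_maps K W W"
    "\<And>a. \<forall>g\<in>carrier A. \<forall>v\<in>carrier V. X a (gv g v) = gv (var_xy K a \<otimes>\<^bsub>A\<^esub> g) v"
    using W_space_letter_maps by blast
  have Xc: "X a w \<in> carrier W" if "w \<in> {gv g v |g v. g \<in> carrier A \<and> v \<in> carrier V}" for a w
    using that by (auto intro: gv_closed linear_maps_closed[OF X(1)])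
  note h = assms(1)[unfolded is_h_iff[of X, OF X(2)]] and \<delta> = assms(2)[unfolded is_\<delta>_iff[of X, OF X(2)]]
  \<comment> \<open>The set \<open>G\<close> consists of all pure tensors, since the predicates give
    the values of \<open>h\<close> and \<open>\<delta>\<close> on words over it.\<close>
  note leibniz = tensor_word_leibniz[OF module_W_space span_gv, folded TW_def]
  show ?thesis
  proof (intro asgder.intro T.nonunital_algebra_axioms asgder_axioms.intro)
    fix a b assume ab: "a \<in> carrier (TW K V)" "b \<in> carrier (TW K V)"
    show "h (a \<otimes>\<^bsub>TW K V\<^esub> b) = h a \<otimes>\<^bsub>TW K V\<^esub> b \<oplus>\<^bsub>TW K V\<^esub> a \<otimes>\<^bsub>TW K V\<^esub> h b"
      by (rule leibniz[where D = "\<lambda>_. X LX" and X = "X LX"]) (use h Xc ab in auto)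
    show "\<delta> (a \<otimes>\<^bsub>TW K V\<^esub> b) = \<delta> a \<otimes>\<^bsub>TW K V\<^esub> b \<oplus>\<^bsub>TW K V\<^esub> a \<otimes>\<^bsub>TW K V\<^esub> h b"
      \<comment> \<open>\<open>D 0\<close> is left multiplication by \<open>y\<close>, and every
        \<open>D (Suc i)\<close> is left multiplication by \<open>x\<close>, the map that belongs to
        \<open>h\<close>.\<close>
      by (rule leibniz[where D = "\<lambda>i. X (case i of 0 \<Rightarrow> LY | Suc j \<Rightarrow> LX)" and X = "X LX"])
        (use h \<delta> Xc ab in auto)
  qed (use h \<delta> in auto)
qed

section \<open>Degree one and the universal property\<close>

lemma gv_tensor_singleton: "gv_tensor K V [(g, v)] = tensor_word K W [gv g v]"
  by (simp add: gv_tensor_def)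

lemma gv_tensor_singleton_closed:
  "g \<in> carrier A \<Longrightarrow> v \<in> carrier V \<Longrightarrow> gv_tensor K V [(g, v)] \<in> carrier (TW K V)"
  unfolding gv_tensor_singleton TW_def by (rule tensor_word_closed[OF module_W_space]) (simp add: gv_closed)

lemma is_h_singleton:
  assumes "is_h K V h" "g \<in> carrier A" "v \<in> carrier V"
  shows "h (gv_tensor K V [(g, v)]) = gv_tensor K V [(var_xy K LX \<otimes>\<^bsub>A\<^esub> g, v)]"
  using assms gv_tensor_singleton_closed[OF A.mult_closed[OF delta_xy_closed assms(2)] assms(3)]
  by (simp add: is_h_def gv_tensor_mult_at_def lessThan_Suc)

text \<open>With a single factor the sum over the later positions is empty and only multiplication
  by \<open>y\<close> is left. Together with \<open>is_h_singleton\<close> this builds up a word in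
  \<open>x\<close> and \<open>y\<close> by applying \<open>h\<close> and
  \<open>\<delta>\<close>.\<close>

lemma is_\<delta>_singleton:
  assumes "is_\<delta> K V \<delta>" "g \<in> carrier A" "v \<in> carrier V"
  shows "\<delta> (gv_tensor K V [(g, v)]) = gv_tensor K V [(var_xy K LY \<otimes>\<^bsub>A\<^esub> g, v)]"
  using assms gv_tensor_singleton_closed[OF A.mult_closed[OF delta_xy_closed assms(2)] assms(3)]
  by (simp add: is_\<delta>_def gv_tensor_mult_at_def)

lemma incl_V_linear: "incl_V K V \<in> linear_maps K V (TW K V)"
proof -
  \<comment> \<open>The empty words around the letter bring the expression into the shape of
    \<open>tensor_word_linear\<close>.\<close>
  have "incl_V K V = (\<lambda>v. tensor_word K W ([] @ [gv (delta_fun K []) v] @ []))"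
    by (simp add: fun_eq_iff incl_V_def one_xy gv_tensor_singleton)
  then show ?thesis
    using linear_maps_compose[OF gv_linear(2)[OF delta_xy_closed, of "[]"]
        tensor_word_linear[OF module_W_space, of "[]" "[]"]]
    by (simp add: TW_def)
qed

text \<open>Applied to solution sets \<open>H\<close> of equations between linear maps: commutation
  of a homomorphism with \<open>h\<close> or \<open>\<delta>\<close>, and equality of two
  morphisms.\<close>

lemma TW_generated:
  assumes "submodule H K (TW K V)"
    and "\<And>a b. a \<in> H \<Longrightarrow> b \<in> H \<Longrightarrow> a \<otimes>\<^bsub>TW K V\<^esub> b \<in> H"
    and "\<And>w v. v \<in> carrier V \<Longrightarrow> gv_tensor K V [(delta_fun K w, v)] \<in> H"
  shows "carrier (TW K V) \<subseteq> H"
  using assms unfolding TW_def gv_tensor_singleton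
  by (intro red_tensor_algebra_generated[OF module_W_space span_gv_words]) auto

lemma asgder_morphism_exists:
  assumes h: "is_h K V h" and \<delta>: "is_\<delta> K V \<delta>" and B: "asgder K B h\<^sub>B \<delta>\<^sub>B" and \<phi>: "\<phi> \<in> linear_maps K V B"
  shows "\<exists>f. f \<in> asgder_morphisms K (TW K V) h \<delta> B h\<^sub>B \<delta>\<^sub>B \<and> (\<forall>v\<in>carrier V. f (incl_V K V v) = \<phi> v)"
proof -
  interpret B: asgder K B h\<^sub>B \<delta>\<^sub>B by (rule B)
  interpret TD: asgder K "TW K V" h \<delta> by (rule asgder_TW[OF h \<delta>])
  note act = letter_action_linear[OF B.h_linear B.\<delta>_linear]
  \<comment> \<open>For fixed \<open>v\<close>, \<open>l v g\<close> is the value at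
    \<open>\<phi> v\<close> of the noncommutative polynomial \<open>g\<close> in the operators
    \<open>h\<^sub>B\<close> and \<open>\<delta>\<^sub>B\<close>, extended linearly from
    words.\<close>
  have "\<exists>l. l \<in> linear_maps K A B \<and> (\<forall>w. l (delta_fun K w) = letter_action h\<^sub>B \<delta>\<^sub>B w (\<phi> v))"
    if v: "v \<in> carrier V" for v
    unfolding free_algebra_xy_def linear_maps_word_algebra
    by (rule free_module_universal[OF V.R.cring_axioms B.module_axioms, of UNIV "\<lambda>w. letter_action h\<^sub>B \<delta>\<^sub>B w (\<phi> v)"])
      (auto intro: linear_maps_closed[OF act linear_maps_closed[OF \<phi> v]])
  then obtain l where l: "\<And>v. v \<in> carrier V \<Longrightarrow> l v \<in> linear_maps K A B"
    "\<And>v w. v \<in> carrier V \<Longrightarrow> l v (delta_fun K w) = letter_action h\<^sub>B \<delta>\<^sub>B w (\<phi> v)"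
    by metis
  note eqA = linear_maps_eq_on_span[OF A.module_axioms
      span_xy _ _ B.module_axioms]
  \<comment> \<open>The maps \<open>l v\<close> were chosen separately for each \<open>v\<close>, so
    linearity in \<open>v\<close> is not built in. Both sides of each equation are linear in
    \<open>g\<close>, which reduces it to words, where \<open>\<phi>\<close> and the operators are
    linear.\<close>
  have r: "(\<lambda>v. l v g) \<in> linear_maps K V B" if g: "g \<in> carrier A" for g
  proof (rule linear_mapsI)
    show "l v g \<in> carrier B" if "v \<in> carrier V" for v
      using linear_maps_closed[OF l(1)[OF that] g] .
    show "l (u \<oplus>\<^bsub>V\<^esub> v) g = l u g \<oplus>\<^bsub>B\<^esub> l v g" if uv: "u \<in> carrier V" "v \<in> carrier V" for u v
    proof (rule eqA[OF _ _ _ g])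
      show "(\<lambda>g. l u g \<oplus>\<^bsub>B\<^esub> l v g) \<in> linear_maps K A B"
        by (intro linear_maps_plus B.module_axioms l uv)
    qed (use uv in \<open>auto simp: l linear_maps_add[OF \<phi>] linear_maps_add[OF act] linear_maps_closed[OF \<phi>]\<close>)
    show "l (c \<odot>\<^bsub>V\<^esub> v) g = c \<odot>\<^bsub>B\<^esub> l v g" if cv: "c \<in> carrier K" "v \<in> carrier V" for c v
    proof (rule eqA[OF _ _ _ g])
      \<comment> \<open>Scaling by \<open>c\<close> is a linear endomorphism because
        \<open>K\<close> is commutative.\<close>
      have "(\<lambda>b. c \<odot>\<^bsub>B\<^esub> b) \<in> linear_maps K B B"
        using cv by (intro linear_mapsI)
          (auto simp: B.smult_r_distr simp flip: B.smult_assoc1 simp: V.R.m_comm)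
      from linear_maps_compose[OF l(1)[OF cv(2)] this]
      show "(\<lambda>g. c \<odot>\<^bsub>B\<^esub> l v g) \<in> linear_maps K A B" .
    qed (use cv in \<open>auto simp: l linear_maps_smult[OF \<phi>] linear_maps_smult[OF act] linear_maps_closed[OF \<phi>]\<close>)
  qed
  obtain f0 where f0: "f0 \<in> linear_maps K W B"
    "\<And>g v. g \<in> carrier A \<Longrightarrow> v \<in> carrier V \<Longrightarrow> f0 (gv g v) = l v g"
    unfolding W_space_def
    by (rule tensor_product_universal[OF A.module_axioms V B.module_axioms l(1) r]) blast+
  obtain f where f: "f \<in> linear_maps K (TW K V) B"
    "\<And>w. w \<in> carrier W \<Longrightarrow> f (tensor_word K W [w]) = f0 w"
    "\<And>a b. a \<in> carrier (TW K V) \<Longrightarrow> b \<in> carrier (TW K V) \<Longrightarrow> f (a \<otimes>\<^bsub>TW K V\<^esub> b) = f a \<otimes>\<^bsub>B\<^esub> f b"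
    unfolding TW_def
    by (rule red_tensor_algebra_hom_exists[OF module_W_space B.nonunital_algebra_axioms f0(1)]) blast
  note fc = linear_maps_closed[OF f(1)] and hc = linear_maps_closed[OF TD.h_linear]
    and \<delta>c = linear_maps_closed[OF TD.\<delta>_linear]
  have word: "f (gv_tensor K V [(delta_fun K w, v)]) = letter_action h\<^sub>B \<delta>\<^sub>B w (\<phi> v)" if "v \<in> carrier V" for w v
    using that by (simp add: gv_tensor_singleton f(2) f0(2) l(2) gv_closed delta_xy_closed)
  have fh: "h\<^sub>B (f a) = f (h a)" if "a \<in> carrier (TW K V)" for a
  proof -
    have "carrier (TW K V) \<subseteq> {a \<in> carrier (TW K V). h\<^sub>B (f a) = f (h a)}"
    proof (rule TW_generated)
      show "submodule {a \<in> carrier (TW K V). h\<^sub>B (f a) = f (h a)} K (TW K V)"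
        by (rule submodule_equalizer[OF T.module_axioms B.module_axioms
              linear_maps_compose[OF f(1) B.h_linear] linear_maps_compose[OF TD.h_linear f(1)]])
    qed (auto simp: T.mult_closed f(3) fc hc TD.h_derivation B.h_derivation linear_maps_add[OF f(1)]
        gv_tensor_singleton_closed delta_xy_closed is_h_singleton[OF h] var_xy_mult word letter_action_simps)
    then show ?thesis using that by blast
  qed
  \<comment> \<open>Closure of this solution set under products is not self-contained: the summand
    \<open>a \<otimes> h b\<close> calls for commutation with \<open>h\<close>, so \<open>fh\<close>
    has to be known first on the whole carrier.\<close>
  have f\<delta>: "\<delta>\<^sub>B (f a) = f (\<delta> a)" if "a \<in> carrier (TW K V)" for a
  proof -
    have "carrier (TW K V) \<subseteq> {a \<in> carrier (TW K V). \<delta>\<^sub>B (f a) = f (\<delta> a)}"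
    proof (rule TW_generated)
      show "submodule {a \<in> carrier (TW K V). \<delta>\<^sub>B (f a) = f (\<delta> a)} K (TW K V)"
        by (rule submodule_equalizer[OF T.module_axioms B.module_axioms
              linear_maps_compose[OF f(1) B.\<delta>_linear] linear_maps_compose[OF TD.\<delta>_linear f(1)]])
    qed (auto simp: T.mult_closed f(3) fc hc \<delta>c TD.\<delta>_mult B.\<delta>_mult fh linear_maps_add[OF f(1)]
        gv_tensor_singleton_closed delta_xy_closed is_\<delta>_singleton[OF \<delta>] var_xy_mult word letter_action_simps)
    then show ?thesis using that by blast
  qed
  \<comment> \<open>Morphisms are extensional, so \<open>f\<close> is cut down to the
    carrier.\<close>
  let ?f = "restrict f (carrier (TW K V))"
  have "?f \<in> linear_maps K (TW K V) B"
    by (rule linear_maps_cong[OF T.module_axioms f(1)]) simp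
  then have "?f \<in> asgder_morphisms K (TW K V) h \<delta> B h\<^sub>B \<delta>\<^sub>B"
    using fh f\<delta> f(3) hc \<delta>c by (simp add: asgder_morphisms_def T.mult_closed)
  moreover have "?f (incl_V K V v) = \<phi> v" if "v \<in> carrier V" for v
    using that word[OF that, of "[]"]
    by (simp add: incl_V_def one_xy gv_tensor_singleton_closed delta_xy_closed letter_action_simps)
  ultimately show ?thesis by blast
qed

lemma asgder_morphism_unique:
  assumes h: "is_h K V h" and \<delta>: "is_\<delta> K V \<delta>" and B: "asgder K B h\<^sub>B \<delta>\<^sub>B"
    and f: "f \<in> asgder_morphisms K (TW K V) h \<delta> B h\<^sub>B \<delta>\<^sub>B" and g: "g \<in> asgder_morphisms K (TW K V) h \<delta> B h\<^sub>B \<delta>\<^sub>B"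
    and eq: "\<And>v. v \<in> carrier V \<Longrightarrow> f (incl_V K V v) = g (incl_V K V v)"
  shows "f = g"
proof -
  interpret B: asgder K B h\<^sub>B \<delta>\<^sub>B by (rule B)
  have f': "f \<in> linear_maps K (TW K V) B" "f \<in> extensional (carrier (TW K V))"
    "\<And>a b. a \<in> carrier (TW K V) \<Longrightarrow> b \<in> carrier (TW K V) \<Longrightarrow> f (a \<otimes>\<^bsub>TW K V\<^esub> b) = f a \<otimes>\<^bsub>B\<^esub> f b"
    "\<And>a. a \<in> carrier (TW K V) \<Longrightarrow> f (h a) = h\<^sub>B (f a)" "\<And>a. a \<in> carrier (TW K V) \<Longrightarrow> f (\<delta> a) = \<delta>\<^sub>B (f a)"
    using f by (auto simp: asgder_morphisms_def)
  have g': "g \<in> linear_maps K (TW K V) B" "g \<in> extensional (carrier (TW K V))"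
    "\<And>a b. a \<in> carrier (TW K V) \<Longrightarrow> b \<in> carrier (TW K V) \<Longrightarrow> g (a \<otimes>\<^bsub>TW K V\<^esub> b) = g a \<otimes>\<^bsub>B\<^esub> g b"
    "\<And>a. a \<in> carrier (TW K V) \<Longrightarrow> g (h a) = h\<^sub>B (g a)" "\<And>a. a \<in> carrier (TW K V) \<Longrightarrow> g (\<delta> a) = \<delta>\<^sub>B (g a)"
    using g by (auto simp: asgder_morphisms_def)
  have word: "f (gv_tensor K V [(delta_fun K w, v)]) = g (gv_tensor K V [(delta_fun K w, v)])" if v: "v \<in> carrier V" for v w
  proof (induction w)
    case Nil
    then show ?case using eq[OF v] by (simp add: incl_V_def one_xy)
  next
    case (Cons a w)
    let ?t = "gv_tensor K V [(delta_fun K w, v)]"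
    have t: "?t \<in> carrier (TW K V)" by (rule gv_tensor_singleton_closed[OF delta_xy_closed v])
    \<comment> \<open>A word grows at its left end, where multiplication by a letter is the action
      of \<open>h\<close> or \<open>\<delta>\<close>; both morphisms carry this action over to
      \<open>B\<close>.\<close>
    have "gv_tensor K V [(delta_fun K (a # w), v)] = (case a of LX \<Rightarrow> h | LY \<Rightarrow> \<delta>) ?t"
      by (cases a) (simp_all add: is_h_singleton[OF h delta_xy_closed v] is_\<delta>_singleton[OF \<delta> delta_xy_closed v] var_xy_mult)
    then show ?case using Cons.IH t by (cases a) (simp_all add: f'(4,5) g'(4,5))
  qed
  have "carrier (TW K V) \<subseteq> {a \<in> carrier (TW K V). f a = g a}"
  proof (rule TW_generated)
    show "submodule {a \<in> carrier (TW K V). f a = g a} K (TW K V)"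
      by (rule submodule_equalizer[OF T.module_axioms B.module_axioms f'(1) g'(1)])
  qed (auto simp: T.mult_closed f'(3) g'(3) word gv_tensor_singleton_closed delta_xy_closed)
  \<comment> \<open>Equality as functions on the whole type: outside the carrier, extensionality
    makes both \<open>undefined\<close>.\<close>
  then show ?thesis
    by (intro extensionalityI[OF f'(2) g'(2)]) blast
qed

end

text \<open>\<open>h\<close> and \<open>\<delta>\<close> enter through predicates that fix them on
  the carrier only, so the universal property is stated for all maps satisfying these. The existence
  clause keeps it from being vacuous.\<close>

theorem proposition2p5:
  fixes K :: "('k, 'm) ring_scheme" and V :: "('k, 'v, 'n) module_scheme"
  assumes "field K" and "char_zero K" and "module K V"
  shows "(\<exists>h \<delta>. is_h K V h \<and> is_\<delta> K V \<delta>) \<and>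
    incl_V K V \<in> linear_maps K V (TW K V) \<and>
    (\<forall>h \<delta>. is_h K V h \<and> is_\<delta> K V \<delta> \<longrightarrow>
      asgder K (TW K V) h \<delta> \<and>
      (\<forall>(B :: ('k, 'b, 'p) module_scheme) h\<^sub>B \<delta>\<^sub>B \<phi>.
        asgder K B h\<^sub>B \<delta>\<^sub>B \<and> \<phi> \<in> linear_maps K V B \<longrightarrow>
        (\<exists>!\<phi>'. \<phi>' \<in> asgder_morphisms K (TW K V) h \<delta> B h\<^sub>B \<delta>\<^sub>B \<and>
          (\<forall>v\<in>carrier V. \<phi>' (incl_V K V v) = \<phi> v))))"
proof (intro conjI allI impI; (elim conjE)?)
  fix h \<delta> h\<^sub>B \<delta>\<^sub>B \<phi> and B :: "('k, 'b, 'p) module_scheme"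
  assume *: "is_h K V h" "is_\<delta> K V \<delta>" "asgder K B h\<^sub>B \<delta>\<^sub>B" "\<phi> \<in> linear_maps K V B"
  show "\<exists>!\<phi>'. \<phi>' \<in> asgder_morphisms K (TW K V) h \<delta> B h\<^sub>B \<delta>\<^sub>B \<and> (\<forall>v\<in>carrier V. \<phi>' (incl_V K V v) = \<phi> v)"
  proof (rule ex_ex1I)
    show "\<exists>\<phi>'. \<phi>' \<in> asgder_morphisms K (TW K V) h \<delta> B h\<^sub>B \<delta>\<^sub>B \<and> (\<forall>v\<in>carrier V. \<phi>' (incl_V K V v) = \<phi> v)"
      by (rule asgder_morphism_exists[OF assms(3) *])
  qed (auto intro: asgder_morphism_unique[OF assms(3) *(1-3)])
qed (rule is_h_is_\<delta>_exist incl_V_linear asgder_TW assms(3); assumption?)+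

end
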